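(* There is an algorithm that, given a deterministic Wheeler graph $W=(V,E)$ and an integer $k\ge 1$, computes the number of distinct $k$-mers contained in $W$ in total time $O((|V|+|E|)k)$.
   Context: A labeled graph has a finite vertex set $V$ and an edge set $E\subseteq V\times V\times\Sigma$, where $\Sigma$ is a finite alphabet totally ordered by $\prec$; an edge $(u,v,a)$ goes from $u$ to $v$ and has label $a$. A $k$-mer is a string $\alpha\in\Sigma^k$. The graph contains $\alpha$ if there is a walk $v_0,\dots,v_k$ with $(v_{i-1},v_i,\alpha[i])\in E$ for all $1\le i\le k$. The graph is deterministic if no two distinct outgoing edges of the same vertex have the same label. It is a Wheeler graph if there is a total ordering $<$ of the nodes (a Wheeler order) such that nodes with no incoming edges precede those with positive indegree, and for every pair of edges $(u,v,a),(u',v',a')$: (W1) $a\prec a'\Rightarrow v<v'$; (W2) $(a=a'\wedge u<u')\Rightarrow v\le v'$. The input Wheeler graph is given together with a Wheeler order of its nodes. Model of computation: Word RAM whose word size is large enough to hold the numbers handled, which are proportional to the maximum number of distinct $\ell$-mers in the graph over $1\le \ell\le k$, so that arithmetic operations on these numbers take constant time. *)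

theory Defs
  imports Main
begin

section \<open>Labeled graphs, k-mers and Wheeler graphs\<close>

type_synonym ('v, 'a) edge = "'v \<times> 'v \<times> 'a"

definition labeled_graph :: "'a set \<Rightarrow> 'v set \<Rightarrow> ('v, 'a) edge set \<Rightarrow> bool" where
  "labeled_graph A V E \<longleftrightarrow> finite A \<and> finite V \<and> E \<subseteq> V \<times> V \<times> A"

definition deterministic :: "('v, 'a) edge set \<Rightarrow> bool" where
  "deterministic E \<longleftrightarrow> (\<forall>u v v' a. (u, v, a) \<in> E \<and> (u, v', a) \<in> E \<longrightarrow> v = v')"

definition contains_string :: "'v set \<Rightarrow> ('v, 'a) edge set \<Rightarrow> 'a list \<Rightarrow> bool" where
  "contains_string V E \<alpha> \<longleftrightarrow>
     (\<exists>p. length p = Suc (length \<alpha>) \<and> set p \<subseteq> V \<and>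
          (\<forall>i < length \<alpha>. (p ! i, p ! Suc i, \<alpha> ! i) \<in> E))"

definition kmers :: "'a set \<Rightarrow> 'v set \<Rightarrow> ('v, 'a) edge set \<Rightarrow> nat \<Rightarrow> 'a list set" where
  "kmers A V E k = {\<alpha> \<in> lists A. length \<alpha> = k \<and> contains_string V E \<alpha>}"

definition has_in_edge :: "('v, 'a) edge set \<Rightarrow> 'v \<Rightarrow> bool" where
  "has_in_edge E v \<longleftrightarrow> (\<exists>u a. (u, v, a) \<in> E)"

text \<open>
  The relation \<open>r\<close> is the strict order of the nodes; the labels are compared by the order of
  their type.
\<close>

definition wheeler_order ::
    "'v set \<Rightarrow> ('v, 'a::linorder) edge set \<Rightarrow> 'v rel \<Rightarrow> bool" where
  "wheeler_order V E r \<longleftrightarrow>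
     strict_linear_order_on V r \<and>
     (\<forall>u \<in> V. \<forall>v \<in> V. \<not> has_in_edge E u \<and> has_in_edge E v \<longrightarrow> (u, v) \<in> r) \<and>
     (\<forall>u v a u' v' a'. (u, v, a) \<in> E \<and> (u', v', a') \<in> E \<longrightarrow>
        (a < a' \<longrightarrow> (v, v') \<in> r) \<and>
        (a = a' \<and> (u, u') \<in> r \<longrightarrow> v = v' \<or> (v, v') \<in> r))"


section \<open>Word RAM\<close>

text \<open>
  Registers and memory cells hold words, that is, numbers below \<open>2 ^ w\<close>, and memory is
  addressed by words. A program is a finite list of instructions; it does not depend on \<open>w\<close>.
  Every instruction takes one unit of time.
\<close>

datatype binop = Add | Sub | Mul | Div | Mod | And | Or | Xor | Shl | Shr

datatype instr =
    Const nat nat         \<comment> \<open>\<open>Const d c\<close>: register \<open>d\<close> becomes the constant \<open>c\<close>\<close>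
  | Op binop nat nat nat  \<comment> \<open>\<open>Op f d a b\<close>: register \<open>d\<close> becomes \<open>f\<close> of registers \<open>a\<close>, \<open>b\<close>\<close>
  | Load nat nat          \<comment> \<open>\<open>Load d a\<close>: register \<open>d\<close> is read from the address in register \<open>a\<close>\<close>
  | Store nat nat         \<comment> \<open>\<open>Store a s\<close>: register \<open>s\<close> is written to the address in register \<open>a\<close>\<close>
  | Jump nat
  | JumpEq nat nat nat    \<comment> \<open>\<open>JumpEq a b l\<close>: jump to \<open>l\<close> if registers \<open>a\<close>, \<open>b\<close> are equal\<close>
  | JumpLess nat nat nat  \<comment> \<open>\<open>JumpLess a b l\<close>: jump to \<open>l\<close> if register \<open>a\<close> is below register \<open>b\<close>\<close>

record ram_state =
  pc :: nat
  reg :: "nat \<Rightarrow> nat"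
  mem :: "nat \<Rightarrow> nat"

text \<open>Results are reduced modulo \<open>2 ^ w\<close>; division by zero follows the convention of HOL.\<close>

fun binop_val :: "nat \<Rightarrow> binop \<Rightarrow> nat \<Rightarrow> nat \<Rightarrow> nat" where
  "binop_val w Add x y = (x + y) mod 2 ^ w"
| "binop_val w Sub x y = (x + (2 ^ w - y)) mod 2 ^ w"
| "binop_val w Mul x y = (x * y) mod 2 ^ w"
| "binop_val w Div x y = (x div y) mod 2 ^ w"
| "binop_val w Mod x y = (x mod y) mod 2 ^ w"
| "binop_val w And x y = (Bit_Operations.and x y) mod 2 ^ w"
| "binop_val w Or x y = (Bit_Operations.or x y) mod 2 ^ w"
| "binop_val w Xor x y = (Bit_Operations.xor x y) mod 2 ^ w"
| "binop_val w Shl x y = (push_bit y x) mod 2 ^ w"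
| "binop_val w Shr x y = (drop_bit y x) mod 2 ^ w"

fun exec :: "nat \<Rightarrow> instr \<Rightarrow> ram_state \<Rightarrow> ram_state" where
  "exec w (Const d c) s = s\<lparr>pc := Suc (pc s), reg := (reg s)(d := c mod 2 ^ w)\<rparr>"
| "exec w (Op f d a b) s =
     s\<lparr>pc := Suc (pc s), reg := (reg s)(d := binop_val w f (reg s a) (reg s b))\<rparr>"
| "exec w (Load d a) s = s\<lparr>pc := Suc (pc s), reg := (reg s)(d := mem s (reg s a))\<rparr>"
| "exec w (Store a b) s = s\<lparr>pc := Suc (pc s), mem := (mem s)(reg s a := reg s b)\<rparr>"
| "exec w (Jump l) s = s\<lparr>pc := l\<rparr>"
| "exec w (JumpEq a b l) s = s\<lparr>pc := if reg s a = reg s b then l else Suc (pc s)\<rparr>"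
| "exec w (JumpLess a b l) s = s\<lparr>pc := if reg s a < reg s b then l else Suc (pc s)\<rparr>"

text \<open>The machine halts when control leaves the program.\<close>

definition halted :: "instr list \<Rightarrow> ram_state \<Rightarrow> bool" where
  "halted P s \<longleftrightarrow> length P \<le> pc s"

definition ram_step :: "nat \<Rightarrow> instr list \<Rightarrow> ram_state \<Rightarrow> ram_state" where
  "ram_step w P s = (if halted P s then s else exec w (P ! pc s) s)"

text \<open>The input occupies the initial memory cells; everything else is zero.\<close>

definition ram_init :: "nat list \<Rightarrow> ram_state" where
  "ram_init xs =
     \<lparr>pc = 0, reg = (\<lambda>_. 0), mem = (\<lambda>i. if i < length xs then xs ! i else 0)\<rparr>"

text \<open>The output is the content of register \<open>0\<close> at halting.\<close>

definition ram_computes_within ::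
    "nat \<Rightarrow> instr list \<Rightarrow> nat list \<Rightarrow> nat \<Rightarrow> nat \<Rightarrow> bool" where
  "ram_computes_within w P xs y T \<longleftrightarrow>
     (\<exists>t \<le> T. halted P ((ram_step w P ^^ t) (ram_init xs)) \<and>
              reg ((ram_step w P ^^ t) (ram_init xs)) 0 = y)"


section \<open>The computational problem\<close>

text \<open>
  Nodes are represented by arbitrary distinct identifiers \<open>0, \<dots>, |V| - 1\<close> (\<open>node_id\<close>), labels
  by words in an order-preserving way (\<open>code\<close>). The input consists of \<open>|V|\<close>, \<open>|E|\<close> and \<open>k\<close>,
  the nodes listed in increasing Wheeler order (\<open>vs\<close>), and the edges listed in an arbitrary
  order (\<open>es\<close>).
\<close>

definition encodes_input ::
    "nat \<Rightarrow> 'a::linorder set \<Rightarrow> 'v set \<Rightarrow> ('v, 'a) edge set \<Rightarrow> 'v rel \<Rightarrow> nat \<Rightarrow> nat list \<Rightarrow> bool"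
  where
  "encodes_input w A V E r k xs \<longleftrightarrow>
     (\<exists>node_id code vs es.
        bij_betw node_id V {..<card V} \<and>
        strict_mono_on A code \<and> code ` A \<subseteq> {..<2 ^ w} \<and>
        distinct vs \<and> set vs = V \<and> sorted_wrt (\<lambda>u v. (u, v) \<in> r) vs \<and>
        distinct es \<and> set es = E \<and>
        xs = [card V, card E, k] @ map node_id vs @
             concat (map (\<lambda>(u, v, a). [node_id u, node_id v, code a]) es))"

definition max_mers :: "'a set \<Rightarrow> 'v set \<Rightarrow> ('v, 'a) edge set \<Rightarrow> nat \<Rightarrow> nat" where
  "max_mers A V E k = Max ((\<lambda>l. card (kmers A V E l)) ` {1..k})"

text \<open>
  Words must hold multiples, by a constant \<open>D\<close>, of the numbers handled: the numbers of
  \<open>l\<close>-mers for \<open>1 \<le> l \<le> k\<close>, and, as usual for a Word RAM, \<open>k\<close> and addresses into the input.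
\<close>

definition word_size_sufficient ::
    "nat \<Rightarrow> nat \<Rightarrow> 'a set \<Rightarrow> 'v set \<Rightarrow> ('v, 'a) edge set \<Rightarrow> nat \<Rightarrow> bool" where
  "word_size_sufficient D w A V E k \<longleftrightarrow>
     D * (max_mers A V E k + card V + card E + k) < 2 ^ w"

text \<open>
  A statement about one program for all graphs has to fix the node and label types; with \<open>nat\<close>
  it covers all graphs, since every finite set and every finite total order embeds into \<open>nat\<close>.
  For \<open>V = {}\<close>, the product \<open>(|V| + |E|) * k\<close> is zero, and the time bound is to be read as
  a constant.
\<close>

end

theory Submission
  imports Defs
begin

text \<open>
  In a deterministic Wheeler graph, if \<open>u < v\<close>, then the \<open>l\<close>-mers ending at \<open>u\<close> precede those ending
  at \<open>v\<close> colexicographically, and the two sets share at most one string. Hence the \<open>l\<close>-mers can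
  be numbered so that those ending at each node have consecutive numbers, and intervals of
  different nodes overlap in at most an endpoint. Appending a label \<open>a\<close> maps the intervals of the
  sources of \<open>a\<close>-edges to intervals of \<open>(l + 1)\<close>-mers, so scanning all edges ordered by label and
  source yields the intervals for \<open>l + 1\<close> in time \<open>O(|V| + |E|)\<close>; a new string repeats an earlier one
  only if it is the last one found. The order of the edges is computed once, by two stable bucket
  sorts.
\<close>

section \<open>Structured programs for the Word RAM\<close>

text \<open>Appending a label \<open>a\<close> to the strings at two nodes yields blocks that
  overlap exactly as the old ones do, and different labels yield disjoint blocks. By determinism the
  edges labeled \<open>a\<close> have distinct sources, so no block is extended twice by one label
  and overlaps stay at one string. Several one-string blocks may repeat the same string in a row; it
  then remains the last one found, so remembering a single edge is enough. By W1 and W2 the targets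
  never decrease along the scan, so the blocks received by one node merge into one interval without
  gaps.

  A second concern is overflow: of the counts, only the final ones are assumed to fit into words.
  After every edge the counter is the number of distinct strings found so far; these are among the
  strings of the new length, so the counter never exceeds the final count.

  The strings themselves and the list of ranks live in the proof only; the machine stores two
  numbers per node. The factor 20 in the word size pays for addresses of 16 interleaved arrays
  behind an input of 3 + |V| + 3|E| cells.\<close>

datatype cond = Less nat nat | Equal nat nat

fun test :: "cond \<Rightarrow> (nat \<Rightarrow> nat) \<Rightarrow> bool" where
  "test (Less a b) r \<longleftrightarrow> r a < r b"
| "test (Equal a b) r \<longleftrightarrow> r a = r b"

text \<open>
  A structured language whose memory is a family of arrays: \<open>Get d j i\<close> loads cell \<open>r i\<close> of
  array \<open>j\<close> into register \<open>d\<close>, and \<open>Put j i a\<close> stores register \<open>a\<close> there. Arrays below 16 are work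
  arrays; they lie behind the input, interleaved with stride 16. Array 16 is the list of nodes
  and arrays 17, 18, 19 are the sources, targets and labels of the edges, all read from the input
  in place. Edges are numbered from 1, so that 0 can serve as the end mark of linked lists.
  Registers from 50 on are reserved for address computations: 50 holds the start of the work
  arrays, 53 the number of nodes, and 54 always holds 0.
\<close>

datatype com =
    Skip
  | SetC nat nat
  | Plus nat nat nat
  | Minus nat nat nat
  | Get nat nat nat
  | Put nat nat nat
  | Seq com com (infixr ";;" 60)
  | Cond cond com com
  | While cond com

definition stride :: "nat \<Rightarrow> nat" where
  "stride j = (if j < 16 then 16 else if j = 16 then 1 else 3)"

text \<open>Array 16 passes over the three header cells by its offset. The edge arrays do so by
  their indices: these start at 1, and the stride is 3.\<close>

definition offset :: "nat \<Rightarrow> nat" where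
  "offset j = (if j < 16 then j else if j = 16 then 3 else j - 17)"

definition base_reg :: "nat \<Rightarrow> nat" where
  "base_reg j = (if j < 16 then 50 else if j = 16 then 54 else 53)"

definition addr_code :: "nat \<Rightarrow> nat \<Rightarrow> instr list" where
  "addr_code j i =
     [Const 51 (stride j), Op Mul 51 i 51, Op Add 51 51 (base_reg j),
      Const 52 (offset j), Op Add 51 51 52]"

fun jump_if :: "cond \<Rightarrow> nat \<Rightarrow> instr" where
  "jump_if (Less a b) l = JumpLess a b l"
| "jump_if (Equal a b) l = JumpEq a b l"

fun code_size :: "com \<Rightarrow> nat" where
  "code_size Skip = 0"
| "code_size (SetC d c) = 1"
| "code_size (Plus d a b) = 1"
| "code_size (Minus d a b) = 1"
| "code_size (Get d j i) = 6"
| "code_size (Put j i a) = 6"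
| "code_size (c1 ;; c2) = code_size c1 + code_size c2"
| "code_size (Cond b c1 c2) = code_size c1 + code_size c2 + 2"
| "code_size (While b c) = code_size c + 3"

text \<open>Conditional jumps exist only in positive form, so the code of the false branch comes
  first, followed by a jump over the true branch, and a failing loop test needs a second jump. The
  clock in \<open>big\<close> mirrors this layout.\<close>

fun compile :: "com \<Rightarrow> nat \<Rightarrow> instr list" where
  "compile Skip l = []"
| "compile (SetC d c) l = [Const d c]"
| "compile (Plus d a b) l = [Op Add d a b]"
| "compile (Minus d a b) l = [Op Sub d a b]"
| "compile (Get d j i) l = addr_code j i @ [Load d 51]"
| "compile (Put j i a) l = addr_code j i @ [Store 51 a]"
| "compile (c1 ;; c2) l = compile c1 l @ compile c2 (l + code_size c1)"
| "compile (Cond b c1 c2) l =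
     jump_if b (l + code_size c2 + 2) # compile c2 (l + 1) @
     Jump (l + code_size c2 + 2 + code_size c1) # compile c1 (l + code_size c2 + 2)"
| "compile (While b c) l =
     jump_if b (l + 2) # Jump (l + code_size c + 3) # compile c (l + 2) @ [Jump l]"

lemma length_compile [simp]: "length (compile c l) = code_size c"
  by (induction c arbitrary: l) (simp_all add: addr_code_def)

fun regs_bounded_cond :: "cond \<Rightarrow> bool" where
  "regs_bounded_cond (Less a b) \<longleftrightarrow> a < 50 \<and> b < 50"
| "regs_bounded_cond (Equal a b) \<longleftrightarrow> a < 50 \<and> b < 50"

fun regs_bounded :: "com \<Rightarrow> bool" where
  "regs_bounded Skip \<longleftrightarrow> True"
| "regs_bounded (SetC d c) \<longleftrightarrow> d < 50"
| "regs_bounded (Plus d a b) \<longleftrightarrow> d < 50 \<and> a < 50 \<and> b < 50"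
| "regs_bounded (Minus d a b) \<longleftrightarrow> d < 50 \<and> a < 50 \<and> b < 50"
| "regs_bounded (Get d j i) \<longleftrightarrow> d < 50 \<and> i < 50"
| "regs_bounded (Put j i a) \<longleftrightarrow> i < 50 \<and> a < 50"
| "regs_bounded (c1 ;; c2) \<longleftrightarrow> regs_bounded c1 \<and> regs_bounded c2"
| "regs_bounded (Cond b c1 c2) \<longleftrightarrow> regs_bounded_cond b \<and> regs_bounded c1 \<and> regs_bounded c2"
| "regs_bounded (While b c) \<longleftrightarrow> regs_bounded_cond b \<and> regs_bounded c"

section \<open>Code segments inside a program and straight-line execution\<close>

definition segment_at :: "instr list \<Rightarrow> nat \<Rightarrow> instr list \<Rightarrow> bool" where
  "segment_at P l c \<longleftrightarrow> (\<exists>pre post. P = pre @ c @ post \<and> length pre = l)"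

lemma segment_at_append:
  "segment_at P l (c @ d) \<longleftrightarrow> segment_at P l c \<and> segment_at P (l + length c) d"
proof
  assume "segment_at P l (c @ d)"
  then obtain pre post where *: "P = pre @ (c @ d) @ post" "length pre = l"
    by (auto simp: segment_at_def)
  have "P = pre @ c @ (d @ post)" "P = (pre @ c) @ d @ post" using * by simp_all
  then show "segment_at P l c \<and> segment_at P (l + length c) d"
    unfolding segment_at_def using *(2) by (metis length_append)
next
  assume "segment_at P l c \<and> segment_at P (l + length c) d"
  then obtain pre post pre' post' where
    1: "P = pre @ c @ post" "length pre = l" and
    2: "P = pre' @ d @ post'" "length pre' = l + length c"
    unfolding segment_at_def by blast
  have "pre' = pre @ c"
    using 1 2 by (metis append.assoc append_eq_append_conv length_append)
  with 1 2 show "segment_at P l (c @ d)" unfolding segment_at_def by (metis append.assoc)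
qed

lemma segment_at_Cons:
  "segment_at P l (x # c) \<longleftrightarrow> segment_at P l [x] \<and> segment_at P (l + 1) c"
  using segment_at_append[of P l "[x]" c] by simp

lemma ram_step_segment:
  assumes "segment_at P (pc s) [x]"
  shows "ram_step w P s = exec w x s"
proof -
  obtain pre post where "P = pre @ x # post" "length pre = pc s"
    using assms by (auto simp: segment_at_def)
  then have "P ! pc s = x" "pc s < length P" by (metis nth_append_length, simp)
  then show ?thesis by (simp add: ram_step_def halted_def)
qed

fun straight :: "instr \<Rightarrow> bool" where
  "straight (Jump l) = False"
| "straight (JumpEq a b l) = False"
| "straight (JumpLess a b l) = False"
| "straight _ = True"

lemma pc_exec_straight: "straight x \<Longrightarrow> pc (exec w x s) = Suc (pc s)"
  by (cases x) auto

lemma ram_step_straight: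
  assumes "segment_at P (pc s) c" "list_all straight c"
  shows "(ram_step w P ^^ length c) s = fold (exec w) c s \<and> pc (fold (exec w) c s) = pc s + length c"
  using assms
proof (induction c arbitrary: s)
  case (Cons x c)
  then have x: "ram_step w P s = exec w x s" and pc: "pc (exec w x s) = Suc (pc s)"
    using ram_step_segment[of P s x w] pc_exec_straight by (auto simp: segment_at_Cons[of _ _ _ c])
  have "segment_at P (pc (exec w x s)) c"
    using Cons.prems pc by (simp add: segment_at_Cons[of _ _ _ c])
  from Cons.IH[OF this] Cons.prems pc x show ?case by (simp add: funpow_swap1 del: funpow.simps) (simp add: funpow_Suc_right del: funpow.simps)
qed simp

section \<open>Memory layout, timed semantics and correctness of compilation\<close>

locale layout =
  fixes w nv ne :: nat
  assumes word_size: "20 * (nv + ne) + 20 \<le> 2 ^ w"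
begin

text \<open>Work arrays are indexed by nodes, by positions in edge lists and by edge numbers up to
  \<open>ne\<close>; the inclusive bound \<open>nv + ne\<close> covers all three uses.\<close>

definition valid :: "nat \<Rightarrow> nat \<Rightarrow> bool" where
  "valid j i \<longleftrightarrow>
     j < 16 \<and> i \<le> nv + ne \<or> j = 16 \<and> i < nv \<or> 17 \<le> j \<and> j < 20 \<and> 1 \<le> i \<and> i \<le> ne"

definition base :: "nat \<Rightarrow> nat" where
  "base j = (if j < 16 then 3 + nv + 3 * ne else if j = 16 then 0 else nv)"

definition addr :: "nat \<Rightarrow> nat \<Rightarrow> nat" where
  "addr j i = i * stride j + base j + offset j"

text \<open>The largest address is \<open>17 * nv + 19 * ne + 18\<close>, reached in work array 15.
  This is the origin of the bound in \<open>word_size\<close>.\<close>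

lemma addr_less: "valid j i \<Longrightarrow> addr j i < 2 ^ w"
  using word_size by (auto simp: valid_def addr_def stride_def base_def offset_def)

text \<open>Only work arrays are written, so it suffices to separate a work cell from any other
  cell. Work cells lie behind the input; among them the residue modulo 16 reveals the array and the
  quotient the index.\<close>

lemma addr_inj:
  assumes "valid j i" "valid j' i'" "j < 16" "addr j i = addr j' i'"
  shows "j = j' \<and> i = i'"
proof -
  have "j' < 16"
    using assms by (auto simp: valid_def addr_def stride_def base_def offset_def split: if_splits)
  with assms(3,4) have *: "j + i * 16 = j' + i' * 16"
    by (simp add: addr_def stride_def base_def offset_def)
  have "j = (j + i * 16) mod 16" "j' = (j' + i' * 16) mod 16"
    "i = (j + i * 16) div 16" "i' = (j' + i' * 16) div 16"
    using \<open>j < 16\<close> \<open>j' < 16\<close> by simp_all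
  with * show ?thesis by metis
qed

text \<open>
  The last number is a clock counting machine instructions. Rules have premises that exclude
  overflow, truncated subtraction and invalid addresses, so that values are plain numbers.
\<close>

inductive big ::
  "com \<Rightarrow> (nat \<Rightarrow> nat) \<Rightarrow> (nat \<Rightarrow> nat \<Rightarrow> nat) \<Rightarrow> nat \<Rightarrow>
   (nat \<Rightarrow> nat) \<Rightarrow> (nat \<Rightarrow> nat \<Rightarrow> nat) \<Rightarrow> nat \<Rightarrow> bool"
where
  big_Skip: "big Skip r g t r g t"
| big_SetC: "c < 2 ^ w \<Longrightarrow> big (SetC d c) r g t (r(d := c)) g (t + 1)"
| big_Plus: "r a + r b < 2 ^ w \<Longrightarrow> big (Plus d a b) r g t (r(d := r a + r b)) g (t + 1)"
| big_Minus: "r b \<le> r a \<Longrightarrow> big (Minus d a b) r g t (r(d := r a - r b)) g (t + 1)"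
| big_Get: "valid j (r i) \<Longrightarrow> big (Get d j i) r g t (r(d := g j (r i))) g (t + 6)"
| big_Put: "j < 16 \<Longrightarrow> valid j (r i) \<Longrightarrow>
    big (Put j i a) r g t r (g(j := (g j)(r i := r a))) (t + 6)"
| big_Seq: "big c1 r g t r' g' t' \<Longrightarrow> big c2 r' g' t' r'' g'' t'' \<Longrightarrow>
    big (c1 ;; c2) r g t r'' g'' t''"
| big_Cond_True: "test b r \<Longrightarrow> big c1 r g (t + 1) r' g' t' \<Longrightarrow> big (Cond b c1 c2) r g t r' g' t'"
| big_Cond_False: "\<not> test b r \<Longrightarrow> big c2 r g (t + 1) r' g' t' \<Longrightarrow>
    big (Cond b c1 c2) r g t r' g' (t' + 1)"
| big_While_True: "test b r \<Longrightarrow> big c r g (t + 1) r' g' t' \<Longrightarrow>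
    big (While b c) r' g' (t' + 1) r'' g'' t'' \<Longrightarrow> big (While b c) r g t r'' g'' t''"
| big_While_False: "\<not> test b r \<Longrightarrow> big (While b c) r g t r g (t + 2)"

inductive_simps big_simps:
  "big Skip r g t r' g' t'"
  "big (SetC d c) r g t r' g' t'"
  "big (Plus d a b) r g t r' g' t'"
  "big (Minus d a b) r g t r' g' t'"
  "big (Get d j i) r g t r' g' t'"
  "big (Put j i a) r g t r' g' t'"
  "big (c1 ;; c2) r g t r' g' t'"
  "big (Cond p c1 c2) r g t r' g' t'"

inductive_simps big_While: "big (While b c) r g t r' g' t'"

text \<open>A run must exist, so this is total correctness; as the clock belongs to the final state,
  postconditions can bound the running time.\<close>

definition wp where
  "wp c Q r g t \<longleftrightarrow> (\<exists>r' g' t'. big c r g t r' g' t' \<and> Q r' g' t')"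

lemma wp_atom:
  "wp Skip Q r g t \<longleftrightarrow> Q r g t"
  "wp (SetC d c) Q r g t \<longleftrightarrow> c < 2 ^ w \<and> Q (r(d := c)) g (t + 1)"
  "wp (Plus d a b) Q r g t \<longleftrightarrow> r a + r b < 2 ^ w \<and> Q (r(d := r a + r b)) g (t + 1)"
  "wp (Minus d a b) Q r g t \<longleftrightarrow> r b \<le> r a \<and> Q (r(d := r a - r b)) g (t + 1)"
  "wp (Get d j i) Q r g t \<longleftrightarrow> valid j (r i) \<and> Q (r(d := g j (r i))) g (t + 6)"
  "wp (Put j i a) Q r g t \<longleftrightarrow>
     j < 16 \<and> valid j (r i) \<and> Q r (g(j := (g j)(r i := r a))) (t + 6)"
  by (auto simp: wp_def big_simps)

lemma wp_Seq: "wp (c1 ;; c2) Q r g t \<longleftrightarrow> wp c1 (wp c2 Q) r g t"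
  unfolding wp_def big_simps by blast

lemma wp_Cond:
  "wp (Cond p c1 c2) Q r g t \<longleftrightarrow>
     (if test p r then wp c1 Q r g (t + 1) else wp c2 (\<lambda>r g t. Q r g (t + 1)) r g (t + 1))"
  by (cases "test p r") (auto simp: wp_def big_simps)

lemmas wp_simps [simp] = wp_atom wp_Seq wp_Cond

lemma wp_While:
  "wp (While b c) Q r g t \<longleftrightarrow>
     (if test b r then wp c (\<lambda>r g t. wp (While b c) Q r g (t + 1)) r g (t + 1) else Q r g (t + 2))"
proof (cases "test b r")
  case True
  then show ?thesis unfolding wp_def by (subst big_While) (simp, blast)
next
  case False
  then show ?thesis unfolding wp_def by (subst big_While) simp
qed

lemma wp_mono:
  "wp c Q r g t \<Longrightarrow> (\<And>r g t. Q r g t \<Longrightarrow> Q' r g t) \<Longrightarrow> wp c Q' r g t"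
  unfolding wp_def by blast

text \<open>For loops whose number of iterations is known beforehand. Indexing the invariant by the
  completed iterations lets it speak about the clock: an iteration pays 1 for the test and 1 for the
  jump back, leaving the loop costs 2.\<close>

lemma wp_While_count:
  assumes "I 0 r g t"
    and "\<And>i r g t. i < n \<Longrightarrow> I i r g t \<Longrightarrow>
      test b r \<and> wp c (\<lambda>r g t. I (Suc i) r g (t + 1)) r g (t + 1)"
    and "\<And>r g t. I n r g t \<Longrightarrow> \<not> test b r \<and> Q r g (t + 2)"
  shows "wp (While b c) Q r g t"
proof -
  have "wp (While b c) Q r g t" if "i \<le> n" "I i r g t" for i r g t
    using that
  proof (induction i arbitrary: r g t rule: inc_induct)
    case base
    then show ?case using assms(3) by (subst wp_While) simp
  next
    case (step i)
    then have "test b r" "wp c (\<lambda>r g t. I (Suc i) r g (t + 1)) r g (t + 1)"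
      using assms(2) by auto
    then show ?case
      by (subst wp_While) (auto elim!: wp_mono intro: step.IH)
  qed
  with assms(1) show ?thesis by blast
qed

text \<open>Registers 51 and 52 are scratch space for addresses and are only required to be words.
  The word bounds belong to the relation because modular subtraction agrees with that of numbers
  only for operands below \<open>2 ^ w\<close>.\<close>

definition simulates ::
  "(nat \<Rightarrow> nat) \<Rightarrow> (nat \<Rightarrow> nat \<Rightarrow> nat) \<Rightarrow> ram_state \<Rightarrow> bool" where
  "simulates r g s \<longleftrightarrow>
     (\<forall>x < 50. reg s x = r x) \<and>
     reg s 50 = 3 + nv + 3 * ne \<and> reg s 53 = nv \<and> reg s 54 = 0 \<and>
     (\<forall>x. reg s x < 2 ^ w) \<and> (\<forall>a. mem s a < 2 ^ w) \<and>
     (\<forall>j i. valid j i \<longrightarrow> mem s (addr j i) = g j i)"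

lemma fold_addr_code:
  assumes "simulates r g s" "valid j (r i)" "i < 50"
  shows "fold (exec w) (addr_code j i) s =
    s\<lparr>pc := pc s + 5, reg := (reg s)(51 := addr j (r i), 52 := offset j)\<rparr>"
proof -
  have *: "stride j < 2 ^ w" "offset j < 2 ^ w" "r i * stride j < 2 ^ w"
    "r i * stride j + base j < 2 ^ w"
    using addr_less[OF assms(2)] assms(2) word_size
    by (auto simp: addr_def valid_def stride_def offset_def)
  moreover have "reg s (base_reg j) = base j" "base_reg j \<noteq> 51"
    using assms(1) by (auto simp: base_reg_def base_def simulates_def)
  ultimately show ?thesis
    using assms addr_less[OF assms(2)]
    by (simp add: addr_code_def simulates_def fun_upd_twist addr_def)
qed

lemma simulates_straight:
  assumes "segment_at P (pc s) c" "list_all straight c" "simulates r' g' (fold (exec w) c s)"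
    "t' = t + length c" "l = pc s + length c"
  shows "\<exists>s' n. (ram_step w P ^^ n) s = s' \<and> t' = t + n \<and> pc s' = l \<and> simulates r' g' s'"
  using ram_step_straight[OF assms(1,2)] assms(3-5) by metis

text \<open>The clock advances by exactly the number of machine steps, so time bounds for structured
  programs carry over without a further factor.\<close>

lemma simulates_compile:
  assumes "big c r g t r' g' t'" "regs_bounded c" "segment_at P (pc s) (compile c (pc s))"
    "simulates r g s"
  shows "\<exists>s' n. (ram_step w P ^^ n) s = s' \<and> t' = t + n \<and> pc s' = pc s + code_size c \<and>
    simulates r' g' s'"
  using assms
proof (induction arbitrary: s rule: big.induct)
  case (big_Skip r g t)
  have "(ram_step w P ^^ 0) s = s" by simp
  with big_Skip show ?case by (intro exI[of _ s] exI[of _ 0]) simp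
next
  case (big_SetC c d r g t)
  then have "simulates (r(d := c)) g (fold (exec w) [Const d c] s)"
    by (auto simp: simulates_def)
  from _ _ this show ?case
    by (rule simulates_straight) (use big_SetC.prems in simp_all)
next
  case (big_Plus r a b d g t)
  then have "simulates (r(d := r a + r b)) g (fold (exec w) [Op Add d a b] s)"
    by (auto simp: simulates_def)
  from _ _ this show ?case
    by (rule simulates_straight) (use big_Plus.prems in simp_all)
next
  case (big_Minus r b a d g t)
  have le: "r b \<le> r a" and eq: "reg s a = r a" "reg s b = r b" and "\<forall>x. reg s x < 2 ^ w"
    using big_Minus by (simp_all add: simulates_def)
  then have lt: "r a < 2 ^ w" by metis
  have "r a + (2 ^ w - r b) = (r a - r b) + 2 ^ w" using le lt by simp
  then have "(r a + (2 ^ w - r b)) mod 2 ^ w = r a - r b"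
    using lt by (metis mod_add_self2 mod_less less_imp_diff_less)
  then have "simulates (r(d := r a - r b)) g (fold (exec w) [Op Sub d a b] s)"
    using big_Minus eq less_imp_diff_less[OF lt, of "r b"] by (auto simp: simulates_def)
  from _ _ this show ?case
    by (rule simulates_straight) (use big_Minus.prems in simp_all)
next
  case (big_Get j r i d g t)
  have "\<forall>a. mem s a < 2 ^ w" "mem s (addr j (r i)) = g j (r i)" "offset j < 2 ^ w"
    using big_Get word_size by (auto simp: simulates_def offset_def valid_def)
  then have "g j (r i) < 2 ^ w" "offset j < 2 ^ w" by metis+
  then have "simulates (r(d := g j (r i))) g (fold (exec w) (addr_code j i @ [Load d 51]) s)"
    using big_Get addr_less[OF big_Get.hyps]
    by (simp add: fold_addr_code) (simp add: simulates_def)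
  from _ _ this show ?case
    by (rule simulates_straight) (use big_Get.prems in \<open>simp_all add: addr_code_def\<close>)
next
  case (big_Put j r i a g t)
  have "offset j < 2 ^ w"
    using big_Put word_size by (auto simp: offset_def valid_def)
  moreover have "\<forall>x. reg s x < 2 ^ w" and eq: "reg s a = r a"
    using big_Put by (simp_all add: simulates_def)
  then have "r a < 2 ^ w" by metis
  moreover note eq
  moreover have "addr j' i' = addr j (r i) \<longleftrightarrow> j' = j \<and> i' = r i" if "valid j' i'" for j' i'
    using addr_inj[OF big_Put.hyps(2) that big_Put.hyps(1)] by auto
  ultimately have "simulates r (g(j := (g j)(r i := r a)))
      (fold (exec w) (addr_code j i @ [Store 51 a]) s)"
    using big_Put addr_less[OF big_Put.hyps(2)]
    by (simp add: fold_addr_code) (simp add: simulates_def)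
  from _ _ this show ?case
    by (rule simulates_straight) (use big_Put.prems in \<open>simp_all add: addr_code_def\<close>)
next
  case (big_Seq c1 r g t r' g' t' c2 r'' g'' t'')
  from big_Seq.prems have "regs_bounded c1" "segment_at P (pc s) (compile c1 (pc s))"
    by (simp_all add: segment_at_append)
  from big_Seq.IH(1)[OF this big_Seq.prems(3)] obtain s1 n1 where
    1: "(ram_step w P ^^ n1) s = s1" "t' = t + n1" "pc s1 = pc s + code_size c1" "simulates r' g' s1"
    by blast
  have "segment_at P (pc s1) (compile c2 (pc s1))"
    using big_Seq.prems 1 by (simp add: segment_at_append)
  from big_Seq.IH(2)[OF _ this 1(4)] big_Seq.prems obtain s2 n2 where
    2: "(ram_step w P ^^ n2) s1 = s2" "t'' = t' + n2" "pc s2 = pc s1 + code_size c2"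
      "simulates r'' g'' s2"
    by auto
  have "(ram_step w P ^^ (n1 + n2)) s = s2"
    using 1(1) 2(1) by (simp add: funpow_add add.commute[of n1])
  with 1 2 show ?case by (intro exI[of _ s2] exI[of _ "n1 + n2"]) simp
next
  case (big_Cond_True b r c1 g t r' g' t' c2)
  let ?s = "s\<lparr>pc := pc s + code_size c2 + 2\<rparr>"
  have jump: "ram_step w P s = ?s"
    using big_Cond_True ram_step_segment[of P s "jump_if b (pc s + code_size c2 + 2)" w]
    by (cases b) (auto simp: segment_at_Cons[of _ _ _ "_ @ _"] simulates_def)
  have "segment_at P (pc ?s) (compile c1 (pc ?s))" "simulates r g ?s"
    using big_Cond_True.prems
    by (simp_all add: segment_at_append segment_at_Cons[of _ _ _ "_ @ _"]
        segment_at_Cons[of _ _ _ "compile _ _"] simulates_def ac_simps)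
  from big_Cond_True.IH[OF _ this] big_Cond_True.prems obtain s1 n1 where
    1: "(ram_step w P ^^ n1) ?s = s1" "t' = t + 1 + n1" "pc s1 = pc ?s + code_size c1"
      "simulates r' g' s1"
    by auto
  have "(ram_step w P ^^ (n1 + 1)) s = s1"
    unfolding funpow_add comp_apply using jump 1(1) by simp
  with 1 show ?case by (intro exI[of _ s1] exI[of _ "n1 + 1"]) simp
next
  case (big_Cond_False b r c2 g t r' g' t' c1)
  let ?s = "s\<lparr>pc := pc s + 1\<rparr>"
  have jump: "ram_step w P s = ?s"
    using big_Cond_False ram_step_segment[of P s "jump_if b (pc s + code_size c2 + 2)" w]
    by (cases b) (auto simp: segment_at_Cons[of _ _ _ "_ @ _"] simulates_def)
  have "segment_at P (pc ?s) (compile c2 (pc ?s))" "simulates r g ?s" and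
    seg: "segment_at P (pc s + 1 + code_size c2) [Jump (pc s + code_size c2 + 2 + code_size c1)]"
    using big_Cond_False.prems
    by (simp_all add: segment_at_append segment_at_Cons[of _ _ _ "_ @ _"]
        segment_at_Cons[of _ _ _ "compile _ _"] simulates_def ac_simps)
  from big_Cond_False.IH[OF _ this(1,2)] big_Cond_False.prems obtain s1 n1 where
    1: "(ram_step w P ^^ n1) ?s = s1" "t' = t + 1 + n1" "pc s1 = pc ?s + code_size c2"
      "simulates r' g' s1"
    by auto
  let ?s2 = "s1\<lparr>pc := pc s + code_size c2 + 2 + code_size c1\<rparr>"
  have jump2: "ram_step w P s1 = ?s2"
    using ram_step_segment[of P s1 "Jump (pc s + code_size c2 + 2 + code_size c1)" w] seg 1(3)
    by simp
  have "(ram_step w P ^^ (1 + (n1 + 1))) s = ?s2"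
    unfolding funpow_add comp_apply using jump 1(1) jump2 by simp
  moreover have "simulates r' g' ?s2" using 1(4) by (simp add: simulates_def)
  ultimately show ?case using 1 by (intro exI[of _ ?s2] exI[of _ "1 + (n1 + 1)"]) simp
next
  case (big_While_True b r c g t r' g' t' r'' g'' t'')
  let ?s = "s\<lparr>pc := pc s + 2\<rparr>"
  have jump: "ram_step w P s = ?s"
    using big_While_True ram_step_segment[of P s "jump_if b (pc s + 2)" w]
    by (cases b) (auto simp: segment_at_Cons[of _ _ _ "_ # _"] simulates_def)
  have "segment_at P (pc ?s) (compile c (pc ?s))" "simulates r g ?s" and
    seg: "segment_at P (pc s + 2 + code_size c) [Jump (pc s)]"
    using big_While_True.prems
    by (simp_all add: segment_at_append segment_at_Cons[of _ _ _ "_ @ _"]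
        segment_at_Cons[of _ _ _ "_ # _"] simulates_def ac_simps)
  from big_While_True.IH(1)[OF _ this(1,2)] big_While_True.prems obtain s1 n1 where
    1: "(ram_step w P ^^ n1) ?s = s1" "t' = t + 1 + n1" "pc s1 = pc ?s + code_size c"
      "simulates r' g' s1"
    by auto
  let ?s2 = "s1\<lparr>pc := pc s\<rparr>"
  have jump2: "ram_step w P s1 = ?s2"
    using ram_step_segment[of P s1 "Jump (pc s)" w] seg 1(3) by simp
  have sim2: "simulates r' g' ?s2" using 1(4) by (simp add: simulates_def)
  from big_While_True.IH(2)[of ?s2] sim2 big_While_True.prems obtain s3 n3 where
    3: "(ram_step w P ^^ n3) ?s2 = s3" "t'' = t' + 1 + n3" "pc s3 = pc s + code_size (While b c)"
      "simulates r'' g'' s3"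
    by auto
  have "(ram_step w P ^^ (n3 + (1 + (n1 + 1)))) s = s3"
    unfolding funpow_add comp_apply using jump 1(1) jump2 3(1) by simp
  with 1 3 show ?case by (intro exI[of _ s3] exI[of _ "n3 + (1 + (n1 + 1))"]) simp
next
  case (big_While_False b r c g t)
  let ?s = "s\<lparr>pc := pc s + code_size c + 3\<rparr>"
  have "ram_step w P s = s\<lparr>pc := pc s + 1\<rparr>"
    using big_While_False ram_step_segment[of P s "jump_if b (pc s + 2)" w]
    by (cases b) (auto simp: segment_at_Cons[of _ _ _ "_ # _"] simulates_def)
  moreover have "ram_step w P (s\<lparr>pc := pc s + 1\<rparr>) = ?s"
    using big_While_False
      ram_step_segment[of P "s\<lparr>pc := pc s + 1\<rparr>" "Jump (pc s + code_size c + 3)" w]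
    by (simp add: segment_at_Cons[of _ _ _ "_ # _"] segment_at_Cons[of _ _ _ "_ @ _"])
  ultimately have "(ram_step w P ^^ 2) s = ?s" by (simp add: numeral_2_eq_2)
  moreover have "simulates r g ?s" using big_While_False by (simp add: simulates_def)
  ultimately show ?case by (intro exI[of _ ?s] exI[of _ 2]) simp
qed

end

section \<open>Numbering the strings that end at each node\<close>

text \<open>The edge set is a parameter separate from \<open>S\<close>, so that the same notion
  describes the strings found when only some of the edges have been scanned.\<close>

definition extensions ::
    "('v, 'a) edge set \<Rightarrow> ('v \<Rightarrow> 'a list set) \<Rightarrow> 'v \<Rightarrow> 'a list set" where
  "extensions E S v = {a # \<alpha> | u a \<alpha>. (u, v, a) \<in> E \<and> \<alpha> \<in> S u}"

text \<open>The strings of length \<open>l\<close> ending at a node, read backwards along the walk.\<close>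

fun mers :: "('v, 'a) edge set \<Rightarrow> nat \<Rightarrow> 'v \<Rightarrow> 'a list set" where
  "mers E 0 = (\<lambda>v. {[]})"
| "mers E (Suc l) = extensions E (mers E l)"

lemma extensions_Un: "extensions (E \<union> F) S v = extensions E S v \<union> extensions F S v"
  by (auto simp: extensions_def)

lemma extensions_empty: "extensions {} S v = {}"
  by (simp add: extensions_def)

lemma extensions_singleton: "extensions {(u, v', a)} S v = (if v = v' then (#) a ` S u else {})"
  by (auto simp: extensions_def)

lemma extensions_mono: "E \<subseteq> F \<Longrightarrow> extensions E S v \<subseteq> extensions F S v"
  by (auto simp: extensions_def)

text \<open>
  The strings ending at \<open>v\<close> are those with ranks \<open>lo v \<le> i < hi v\<close>; \<open>hi v = 0\<close> encodes that there
  are none. While the edges are scanned, \<open>c\<close> counts the extended strings found so far, and \<open>la\<close>, \<open>lr\<close>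
  are the label and the value \<open>hi\<close> of the source of the last edge. The first string contributed by
  an edge is a repetition only if it also is the last one contributed by the previous edge.
\<close>

type_synonym round_state = "nat \<times> nat \<times> nat \<times> (nat \<Rightarrow> nat) \<times> (nat \<Rightarrow> nat)"

definition process ::
    "(nat \<Rightarrow> nat) \<Rightarrow> (nat \<Rightarrow> nat) \<Rightarrow> (nat, nat) edge \<Rightarrow> round_state \<Rightarrow> round_state" where
  "process lo hi = (\<lambda>(u, v, a) (c, la, lr, lo', hi').
     if hi u = 0 then (c, la, lr, lo', hi')
     else
       let c0 = (if a = la \<and> lo u + 1 = lr then c - 1 else c);
           c1 = c0 + (hi u - lo u)
       in (c1, a, hi u, if hi' v = 0 then lo'(v := c0) else lo', hi'(v := c1)))"

section \<open>One round: from intervals of l-mers to intervals of (l + 1)-mers\<close>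

locale ranked_nodes =
  fixes V :: "nat set" and rk :: "nat \<Rightarrow> nat"
  assumes inj_rk: "inj_on rk V"
begin

text \<open>The strict inequality of sources is where determinism enters: one source never extends
  its strings twice by the same label.\<close>

definition edge_less :: "(nat, nat) edge \<Rightarrow> (nat, nat) edge \<Rightarrow> bool" where
  "edge_less = (\<lambda>(u, v, a) (u', v', a').
     a \<le> a' \<and> rk v \<le> rk v' \<and> (a = a' \<longrightarrow> rk u < rk u'))"

text \<open>The list \<open>M\<close> need not be sorted: only the positions of the intervals matter.\<close>

definition consistent ::
    "(nat \<Rightarrow> nat list set) \<Rightarrow> nat list list \<Rightarrow> (nat \<Rightarrow> nat) \<Rightarrow> (nat \<Rightarrow> nat) \<Rightarrow> bool" where
  "consistent S M lo hi \<longleftrightarrow>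
     distinct M \<and> set M = (\<Union>v\<in>V. S v) \<and>
     (\<forall>v\<in>V. S v = (!) M ` {lo v..<hi v} \<and> hi v \<le> length M \<and> (hi v \<noteq> 0 \<longrightarrow> lo v < hi v)) \<and>
     (\<forall>u\<in>V. \<forall>v\<in>V. rk u < rk v \<and> hi u \<noteq> 0 \<and> hi v \<noteq> 0 \<longrightarrow> hi u \<le> lo v + 1)"

text \<open>The first alternative means that no scanned edge has contributed a string. Then
  \<open>lr = 0\<close> rules out a match with \<open>lo u + 1\<close>, whereas the initial
  \<open>la\<close> may well be a genuine label. In the second alternative the latest contributing
  edge is the greatest one, and its last string is the last entry of \<open>M'\<close>.\<close>

definition round_inv where
  "round_inv S M lo hi Ls = (\<lambda>(c, la, lr, lo', hi').
     \<exists>M'. length M' = c \<and> consistent (extensions Ls S) M' lo' hi' \<and>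
       ((\<forall>(u, v, a)\<in>Ls. hi u = 0) \<and> lr = 0 \<or>
        (\<exists>u v a. (u, v, a) \<in> Ls \<and> hi u \<noteq> 0 \<and> la = a \<and> lr = hi u \<and> hi' v = c \<and> c \<noteq> 0 \<and>
          M' ! (c - 1) = a # M ! (hi u - 1) \<and>
          (\<forall>e\<in>Ls. hi (fst e) \<noteq> 0 \<longrightarrow> e = (u, v, a) \<or> edge_less e (u, v, a)))))"

text \<open>The crux is that a string counted as new is new. An earlier copy would stem from an edge
  with the same label and a smaller source, whose interval ends no later than the first rank of
  \<open>u\<close>. The latest contributing edge lies between these two, so it also has this label
  and its source ends at this rank; hence the test would have recognized the repetition.\<close>

lemma round_inv_process:
  assumes S: "consistent S M lo hi" and inv: "round_inv S M lo hi Ls st"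
    and e: "u \<in> V" "v \<in> V" and Ls: "Ls \<subseteq> V \<times> V \<times> UNIV"
    and less: "\<And>e. e \<in> Ls \<Longrightarrow> edge_less e (u, v, a)"
  shows "round_inv S M lo hi (insert (u, v, a) Ls) (process lo hi (u, v, a) st)"
proof (cases "hi u = 0")
  case True
  then have "S u = {}" using S e by (simp add: consistent_def)
  then have "extensions (insert (u, v, a) Ls) S = extensions Ls S"
    by (auto simp: extensions_def fun_eq_iff)
  then show ?thesis
    using True inv unfolding round_inv_def
    by (cases st) (simp add: process_def del: split_paired_Ex split_paired_All, blast)
next
  case False
  obtain c la lr lo' hi' where st: "st = (c, la, lr, lo', hi')" by (cases st)
  from inv st obtain M' where lenM': "length M' = c" and
    con: "consistent (extensions Ls S) M' lo' hi'" and
    last: "(\<forall>(u, v, a)\<in>Ls. hi u = 0) \<and> lr = 0 \<or>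
        (\<exists>u v a. (u, v, a) \<in> Ls \<and> hi u \<noteq> 0 \<and> la = a \<and> lr = hi u \<and> hi' v = c \<and> c \<noteq> 0 \<and>
          M' ! (c - 1) = a # M ! (hi u - 1) \<and>
          (\<forall>e\<in>Ls. hi (fst e) \<noteq> 0 \<longrightarrow> e = (u, v, a) \<or> edge_less e (u, v, a)))"
    unfolding round_inv_def by auto
  have distM: "distinct M" and Su: "S u = (!) M ` {lo u..<hi u}" and
    lohi: "lo u < hi u" and hiM: "hi u \<le> length M"
    using S e False by (auto simp: consistent_def)
  have origin: "\<exists>u0 a0 i. (u0, v0, a0) \<in> Ls \<and> x = a0 # M ! i \<and> lo u0 \<le> i \<and> i < hi u0 \<and> hi u0 \<noteq> 0 \<and> u0 \<in> V"
    if x: "x \<in> extensions Ls S v0" for x v0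
  proof -
    from x obtain u0 a0 \<alpha> where *: "(u0, v0, a0) \<in> Ls" "\<alpha> \<in> S u0" "x = a0 # \<alpha>"
      by (auto simp: extensions_def)
    then have "u0 \<in> V" using Ls by auto
    with * S obtain i where "\<alpha> = M ! i" "lo u0 \<le> i" "i < hi u0"
      by (auto simp: consistent_def)
    with * \<open>u0 \<in> V\<close> show ?thesis by (intro exI[of _ u0] exI[of _ a0] exI[of _ i]) auto
  qed
  define ov where "ov \<longleftrightarrow> a = la \<and> lo u + 1 = lr"
  \<comment> \<open>In case of a repetition, \<open>s\<close> skips the first string of
    \<open>u\<close> when strings are appended, while \<open>c0\<close> lets the new interval begin
    at the existing copy.\<close>
  define s where "s = (if ov then lo u + 1 else lo u)"
  define c0 where "c0 = (if ov then c - 1 else c)"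
  define c1 where "c1 = c0 + (hi u - lo u)"
  define N where "N = map (\<lambda>i. a # M ! i) [s..<hi u]"
  define lo'' where "lo'' = (if hi' v = 0 then lo'(v := c0) else lo')"
  define hi'' where "hi'' = hi'(v := c1)"
  have ov_c: "c \<noteq> 0 \<and> M' ! (c - 1) = a # M ! lo u" if ov
  proof -
    from that have lr: "lr = lo u + 1" "a = la" by (simp_all add: ov_def)
    have "lr = 0 \<or> c \<noteq> 0 \<and> M' ! (c - 1) = la # M ! (lr - 1)" using last by blast
    with lr show ?thesis by simp
  qed
  have proc: "process lo hi (u, v, a) st = (c1, a, hi u, lo'', hi'')"
    using False by (simp add: st process_def Let_def c1_def c0_def lo''_def hi''_def ov_def)
  have len: "length (M' @ N) = c1"
    using ov_c lohi by (auto simp: N_def c1_def c0_def s_def lenM')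
  have cc: "c0 \<le> c" "c \<le> c1" "c0 < c1"
    using ov_c lohi by (auto simp: c0_def c1_def)
  have new: "(M' @ N) ! (c0 + (i - lo u)) = a # M ! i" if "lo u \<le> i" "i < hi u" for i
  proof (cases "ov \<and> i = lo u")
    case True
    then show ?thesis using ov_c by (simp add: c0_def nth_append lenM')
  next
    case False
    then have idx: "c0 + (i - lo u) = length M' + (i - s)" and "s \<le> i"
      using ov_c that by (auto simp: c0_def s_def lenM')
    with that show ?thesis unfolding idx nth_append_length_plus by (simp add: N_def nth_map_upt)
  qed
  have image_new: "(!) (M' @ N) ` {c0..<c1} = (#) a ` S u"
  proof -
    have "{c0..<c1} = (\<lambda>i. c0 + (i - lo u)) ` {lo u..<hi u}"
    proof (intro equalityI subsetI)
      fix x assume "x \<in> {c0..<c1}"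
      then have "x = c0 + ((x - c0 + lo u) - lo u)" "x - c0 + lo u \<in> {lo u..<hi u}"
        by (auto simp: c1_def)
      then show "x \<in> (\<lambda>i. c0 + (i - lo u)) ` {lo u..<hi u}" by blast
    qed (auto simp: c1_def)
    then have "(!) (M' @ N) ` {c0..<c1} = (\<lambda>i. (M' @ N) ! (c0 + (i - lo u))) ` {lo u..<hi u}"
      by (simp only: image_image)
    also have "\<dots> = (\<lambda>i. a # M ! i) ` {lo u..<hi u}"
      by (intro image_cong refl new) auto
    finally show ?thesis by (simp only: Su image_image)
  qed
  have old: "(!) (M' @ N) ` {i..<j} = (!) M' ` {i..<j}" if "j \<le> c" for i j
    using that lenM' by (intro image_cong) (auto simp: nth_append)
  have fresh: "x \<notin> set N" if x: "x \<in> set M'" for x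
  proof
    assume "x \<in> set N"
    then obtain j where j: "x = a # M ! j" "s \<le> j" "j < hi u" by (auto simp: N_def)
    have "set M' = (\<Union>v\<in>V. extensions Ls S v)" using con by (simp only: consistent_def)
    with x obtain v0 where "x \<in> extensions Ls S v0" by blast
    from origin[OF this] obtain u0 i where i: "(u0, v0, a) \<in> Ls" "M ! i = M ! j"
      "lo u0 \<le> i" "i < hi u0" "hi u0 \<noteq> 0" "u0 \<in> V" using j(1) by auto
    have "rk u0 < rk u" using less[OF i(1)] by (simp add: edge_less_def)
    then have u0: "hi u0 \<le> lo u + 1" using S e i False by (auto simp: consistent_def)
    have "i < length M" "j < length M"
      using i S hiM j unfolding consistent_def by (meson less_le_trans)+
    with i(2) distM have "i = j" by (simp add: nth_eq_iff_index_eq)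
    \<comment> \<open>The two intervals can only meet at \<open>lo u\<close>; as
      \<open>s <= j\<close>, this rank was not skipped, so no repetition was announced.\<close>
    with i u0 j have "j = lo u" "hi u0 = lo u + 1" and nov: "\<not> ov"
      by (auto simp: s_def split: if_splits)
    \<comment> \<open>The latest contributing edge is squeezed between the edge that produced the
      copy and the new edge.\<close>
    from last i obtain u1 v1 where 1: "(u1, v1, la) \<in> Ls" "hi u1 \<noteq> 0" "lr = hi u1"
      "(u0, v0, a) = (u1, v1, la) \<or> edge_less (u0, v0, a) (u1, v1, la)"
      by fastforce
    have "la \<le> a" using less[OF 1(1)] by (simp add: edge_less_def)
    with 1(4) have la: "a = la" by (auto simp: edge_less_def)
    have "u1 \<in> V" using 1 Ls by auto
    have "rk u1 < rk u" using less[OF 1(1)] la by (simp add: edge_less_def)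
    then have "hi u1 \<le> lo u + 1"
      using S e \<open>u1 \<in> V\<close> 1(2) False by (auto simp: consistent_def)
    moreover have "hi u0 \<le> hi u1"
    proof (cases "u0 = u1")
      case False
      with 1(4) la have "rk u0 < rk u1" by (auto simp: edge_less_def)
      then have "hi u0 \<le> lo u1 + 1" "lo u1 < hi u1"
        using S i \<open>u1 \<in> V\<close> 1(2) by (auto simp: consistent_def)
      then show ?thesis by simp
    qed simp
    ultimately have "lo u + 1 = lr" using \<open>hi u0 = lo u + 1\<close> 1(3) by simp
    with la nov show False by (simp add: ov_def)
  qed
  have "distinct N" using distM hiM
    by (auto simp: N_def distinct_map inj_on_def nth_eq_iff_index_eq)
  have ext: "extensions (insert (u, v, a) Ls) S v0 = extensions Ls S v0 \<union> (if v0 = v then (#) a ` S u else {})"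
    for v0
    using extensions_Un[of "{(u, v, a)}" Ls S v0] by (auto simp: extensions_singleton)
  have nonempty: "\<exists>u0 a0. (u0, v0, a0) \<in> Ls \<and> hi u0 \<noteq> 0" if "hi' v0 \<noteq> 0" "v0 \<in> V" for v0
  proof -
    from that con have "extensions Ls S v0 \<noteq> {}" by (auto simp: consistent_def)
    then show ?thesis using origin by blast
  qed
  \<comment> \<open>Targets never decrease, so a node that already has an interval and receives
    another edge is still the target of the latest contributing edge. Its interval reaches up to
    \<open>c\<close> and can simply be prolonged.\<close>
  have hi_v: "hi' v = c" if "hi' v \<noteq> 0"
  proof -
    from nonempty[OF that e(2)] obtain u0 a0 where 0: "(u0, v, a0) \<in> Ls" "hi u0 \<noteq> 0" by blast
    with last obtain u1 v1 where 1: "(u1, v1, la) \<in> Ls" "hi' v1 = c"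
      "(u0, v, a0) = (u1, v1, la) \<or> edge_less (u0, v, a0) (u1, v1, la)"
      by fastforce
    have "rk v \<le> rk v1" "rk v1 \<le> rk v" using 1(3) less[OF 1(1)] by (auto simp: edge_less_def)
    moreover have "v1 \<in> V" using 1 Ls by auto
    ultimately have "v1 = v" using inj_rk e by (auto simp: inj_on_def)
    with 1 show ?thesis by simp
  qed
  have before: "rk v0 \<le> rk v" if "hi' v0 \<noteq> 0" "v0 \<in> V" for v0
    using nonempty[OF that] less by (auto simp: edge_less_def)
  have hi_c: "hi' v0 \<le> c" if "v0 \<in> V" for v0 using con lenM' that by (auto simp: consistent_def)
  have "consistent (extensions (insert (u, v, a) Ls) S) (M' @ N) lo'' hi''"
    unfolding consistent_def
  proof (intro conjI ballI impI)
    show "distinct (M' @ N)"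
      using con \<open>distinct N\<close> fresh by (auto simp: consistent_def)
    have "set M' = (\<Union>v\<in>V. extensions Ls S v)" using con by (simp add: consistent_def)
    moreover have "set N \<subseteq> (#) a ` S u" unfolding Su N_def by (auto simp: s_def split: if_splits)
    moreover have "(#) a ` S u \<subseteq> set (M' @ N)"
      unfolding image_new[symmetric] using len by (auto simp del: length_append set_append)
    moreover have "(\<Union>v0\<in>V. extensions (insert (u, v, a) Ls) S v0) =
        (\<Union>v0\<in>V. extensions Ls S v0) \<union> (#) a ` S u"
      using e unfolding ext by (auto split: if_splits)
    ultimately show "set (M' @ N) = (\<Union>v0\<in>V. extensions (insert (u, v, a) Ls) S v0)"
      by auto
  next
    fix v0 assume v0: "v0 \<in> V"
    have old0: "extensions Ls S v0 = (!) (M' @ N) ` {lo' v0..<hi' v0}"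
      using con v0 old[OF hi_c[OF v0]] by (auto simp: consistent_def)
    show "extensions (insert (u, v, a) Ls) S v0 = (!) (M' @ N) ` {lo'' v0..<hi'' v0}"
    proof (cases "v0 = v")
      case False
      then show ?thesis using old0 by (simp add: ext lo''_def hi''_def)
    next
      case True
      show ?thesis
      proof (cases "hi' v = 0")
        case hi0: True
        then show ?thesis using True old0 image_new by (simp add: ext lo''_def hi''_def)
      next
        case False
        then have "lo' v < c" using con e hi_v by (auto simp: consistent_def)
        \<comment> \<open>This also holds when \<open>c0\<close> is \<open>c - 1\<close>; as
          \<open>c0 <= c\<close>, the old and the new part have no gap between them.\<close>
        then have "lo' v \<le> c0" by (auto simp: c0_def)
        then have "{lo' v..<c1} = {lo' v..<c} \<union> {c0..<c1}" using cc by auto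
        then show ?thesis
          using True False old0 image_new hi_v[OF False]
          by (simp add: ext lo''_def hi''_def image_Un)
      qed
    qed
    show "hi'' v0 \<le> length (M' @ N)"
      unfolding len using hi_c[OF v0] cc by (simp add: hi''_def)
    show "lo'' v0 < hi'' v0" if "hi'' v0 \<noteq> 0"
    proof (cases "v0 = v")
      case True
      then show ?thesis using cc con e hi_v by (auto simp: lo''_def hi''_def consistent_def)
    next
      case False
      then show ?thesis using that con v0 by (auto simp: lo''_def hi''_def consistent_def)
    qed
  next
    fix u0 v0 assume 0: "u0 \<in> V" "v0 \<in> V" "rk u0 < rk v0 \<and> hi'' u0 \<noteq> 0 \<and> hi'' v0 \<noteq> 0"
    consider "v0 = v" "u0 \<noteq> v" | "u0 = v" "v0 \<noteq> v" | "u0 \<noteq> v" "v0 \<noteq> v" using 0 by auto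
    then show "hi'' u0 \<le> lo'' v0 + 1"
    proof cases
      case 1
      \<comment> \<open>Going back by at most one rank is what limits the overlap of different nodes
        to one string.\<close>
      have "c \<le> c0 + 1" by (auto simp: c0_def)
      then show ?thesis
        using 1 0 hi_c[OF 0(1)] con by (auto simp: lo''_def hi''_def consistent_def)
    next
      case 2
      then show ?thesis using before[of v0] 0 by (auto simp: hi''_def)
    next
      case 3
      then show ?thesis using 0 con by (auto simp: lo''_def hi''_def consistent_def)
    qed
  qed
  moreover have "(M' @ N) ! (c1 - 1) = a # M ! (hi u - 1)"
    using new[of "hi u - 1"] lohi by (simp add: c1_def)
  ultimately show ?thesis
    unfolding proc round_inv_def prod.case
    using len False cc less
    by (intro exI[of _ "M' @ N"] conjI disjI2 exI[of _ u] exI[of _ v] exI[of _ a])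
      (auto simp: hi''_def)
qed

lemma round_inv_empty: "\<forall>v\<in>V. hi' v = 0 \<Longrightarrow> round_inv S M lo hi {} (0, la, 0, lo', hi')"
  by (auto simp: round_inv_def consistent_def extensions_empty intro!: exI[of _ "[]"])

text \<open>Only \<open>hi'\<close> must be zero before a round: it marks a node as not yet reached,
  and \<open>process\<close> sets \<open>lo'\<close> when it first reaches the node. Stale values in
  \<open>lo'\<close> are therefore harmless.\<close>

lemma round_inv_fold:
  assumes "consistent S M lo hi" "sorted_wrt edge_less L" "set L \<subseteq> V \<times> V \<times> UNIV"
    "\<forall>v\<in>V. hi' v = 0"
  shows "round_inv S M lo hi (set L) (fold (process lo hi) L (0, la, 0, lo', hi'))"
  using assms(2,3)
proof (induction L rule: rev_induct)
  case Nil
  then show ?case using round_inv_empty assms(4) by simp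
next
  case (snoc e L)
  obtain u v a where "e = (u, v, a)" by (cases e)
  with snoc show ?case
    using round_inv_process[OF assms(1), of "set L" _ u v a]
    by (simp add: sorted_wrt_append)
qed

lemma consistent_cong:
  assumes "\<And>v. v \<in> V \<Longrightarrow> lo v = lo' v" "\<And>v. v \<in> V \<Longrightarrow> hi v = hi' v"
  shows "consistent S M lo hi \<longleftrightarrow> consistent S M lo' hi'"
  using assms by (auto simp: consistent_def)

lemma consistent_card:
  "consistent S M lo hi \<Longrightarrow> card (\<Union>v\<in>V. S v) = length M"
  unfolding consistent_def by (metis distinct_card)

text \<open>All nodes share the rank of the empty string, which the permitted overlap of one string
  allows.\<close>

lemma consistent_0: "V \<noteq> {} \<Longrightarrow> consistent (mers E 0) [[]] (\<lambda>_. 0) (\<lambda>_. 1)"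
  by (auto simp: consistent_def)

end

section \<open>Walks, k-mers and invariance under encoding\<close>

lemma mers_iff_walk:
  assumes E: "E \<subseteq> V \<times> V \<times> A" and "v \<in> V"
  shows "\<alpha> \<in> mers E l v \<longleftrightarrow>
    length \<alpha> = l \<and> (\<exists>p. length p = Suc l \<and> set p \<subseteq> V \<and> last p = v \<and>
      (\<forall>i<l. (p ! i, p ! Suc i, rev \<alpha> ! i) \<in> E))"
  using \<open>v \<in> V\<close>
proof (induction l arbitrary: \<alpha> v)
  case 0
  then show ?case by (auto simp: length_Suc_conv intro!: exI[of _ "[v]"])
next
  case (Suc l)
  show ?case
  proof (intro iffI conjI)
    assume "\<alpha> \<in> mers E (Suc l) v"
    then obtain a u \<beta> where *: "\<alpha> = a # \<beta>" "(u, v, a) \<in> E" "\<beta> \<in> mers E l u"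
      by (auto simp: extensions_def)
    then have "u \<in> V" using E by auto
    from Suc.IH[OF this] * obtain p where p: "length \<beta> = l" "length p = Suc l" "set p \<subseteq> V"
      "last p = u" "\<forall>i<l. (p ! i, p ! Suc i, rev \<beta> ! i) \<in> E"
      by auto
    then show "length \<alpha> = Suc l" using * by simp
    have "p ! l = u" using p by (metis diff_Suc_1 last_conv_nth length_0_conv nat.distinct(1))
    then have "((p @ [v]) ! i, (p @ [v]) ! Suc i, rev \<alpha> ! i) \<in> E" if "i < Suc l" for i
      using p * that by (cases "i = l") (auto simp: nth_append)
    with p Suc.prems show "\<exists>p. length p = Suc (Suc l) \<and> set p \<subseteq> V \<and> last p = v \<and>
      (\<forall>i<Suc l. (p ! i, p ! Suc i, rev \<alpha> ! i) \<in> E)"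
      by (intro exI[of _ "p @ [v]"]) auto
  next
    assume "length \<alpha> = Suc l \<and> (\<exists>p. length p = Suc (Suc l) \<and> set p \<subseteq> V \<and> last p = v \<and>
      (\<forall>i<Suc l. (p ! i, p ! Suc i, rev \<alpha> ! i) \<in> E))"
    moreover from this obtain a \<beta> where "\<alpha> = a # \<beta>" "length \<beta> = l" by (cases \<alpha>) auto
    ultimately obtain p where p: "\<alpha> = a # \<beta>" "length \<beta> = l" "length p = Suc (Suc l)"
      "set p \<subseteq> V" "last p = v" "\<forall>i<Suc l. (p ! i, p ! Suc i, rev \<alpha> ! i) \<in> E"
      by blast
    define q where "q = butlast p"
    have pq: "p = q @ [v]" using p by (metis append_butlast_last_id length_0_conv nat.distinct(1) q_def)
    with p have q: "length q = Suc l" "set q \<subseteq> V" by auto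
    then have last: "last q = q ! l" "q \<noteq> []"
      by (metis diff_Suc_1 last_conv_nth length_0_conv nat.distinct(1)) (use q in auto)
    have "(q ! i, q ! Suc i, rev \<beta> ! i) \<in> E" if "i < l" for i
      using p(6)[rule_format, of i] that q p(1,2) by (simp add: pq nth_append)
    moreover have "(last q, v, a) \<in> E"
      using p(6)[rule_format, of l] q p(1,2) by (simp add: pq nth_append last)
    moreover have "last q \<in> V" using q(2) last(2) by auto
    ultimately show "\<alpha> \<in> mers E (Suc l) v"
      using Suc.IH[of "last q" \<beta>] q p(1,2) by (auto simp: extensions_def)
  qed
qed

lemma mers_lists:
  "E \<subseteq> V \<times> V \<times> A \<Longrightarrow> mers E l v \<subseteq> lists A"
  by (induction l arbitrary: v) (fastforce simp: extensions_def)+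

lemma kmers_eq_mers:
  assumes E: "E \<subseteq> V \<times> V \<times> A"
  shows "kmers A V E k = rev ` (\<Union>v\<in>V. mers E k v)"
proof (intro equalityI subsetI)
  fix \<alpha> assume "\<alpha> \<in> kmers A V E k"
  then obtain p where p: "length \<alpha> = k" "length p = Suc k" "set p \<subseteq> V"
    "\<forall>i<k. (p ! i, p ! Suc i, \<alpha> ! i) \<in> E"
    by (auto simp: kmers_def contains_string_def)
  then have "last p \<in> V" by (metis last_in_set length_0_conv nat.distinct(1) subsetD)
  with p have "rev \<alpha> \<in> mers E k (last p)"
    by (subst mers_iff_walk[OF E]) auto
  with \<open>last p \<in> V\<close> show "\<alpha> \<in> rev ` (\<Union>v\<in>V. mers E k v)"
    by (metis UN_I image_eqI rev_rev_ident)
next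
  fix \<alpha> assume "\<alpha> \<in> rev ` (\<Union>v\<in>V. mers E k v)"
  then obtain v \<beta> where v: "v \<in> V" "\<beta> \<in> mers E k v" "\<alpha> = rev \<beta>" by auto
  moreover have "\<beta> \<in> lists A" using v mers_lists[OF E] by blast
  ultimately show "\<alpha> \<in> kmers A V E k"
    using mers_iff_walk[OF E v(1)] by (auto simp: kmers_def contains_string_def)
qed

text \<open>Identifying nodes could create new walks, while identifying labels only identifies
  strings. So injectivity on nodes matters here and injectivity on labels when strings are
  counted.\<close>

lemma mers_encode:
  assumes E: "E \<subseteq> V \<times> V \<times> A" and f: "inj_on f V" and "v \<in> V"
  shows "mers ((\<lambda>(u, v, a). (f u, f v, c a)) ` E) l (f v) = map c ` mers E l v"
  using \<open>v \<in> V\<close>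
proof (induction l arbitrary: v)
  case (Suc l)
  have "mers ((\<lambda>(u, v, a). (f u, f v, c a)) ` E) (Suc l) (f v) =
      {c a # \<alpha> | u a \<alpha>. (u, v, a) \<in> E \<and> \<alpha> \<in> map c ` mers E l u}" (is "?L = ?R")
  proof (intro equalityI subsetI)
    fix x assume "x \<in> ?L"
    then obtain y b \<alpha> where 1: "(y, f v, b) \<in> (\<lambda>(u, v, a). (f u, f v, c a)) ` E" "x = b # \<alpha>"
      "\<alpha> \<in> mers ((\<lambda>(u, v, a). (f u, f v, c a)) ` E) l y"
      unfolding mers.simps extensions_def by blast
    then obtain u v' a where "(u, v', a) \<in> E" "f v' = f v" "y = f u" "b = c a" by auto
    with 1 have *: "(u, v', a) \<in> E" "f v' = f v" "x = c a # \<alpha>"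
      "\<alpha> \<in> mers ((\<lambda>(u, v, a). (f u, f v, c a)) ` E) l (f u)" by simp_all
    from *(1) E have "u \<in> V" "v' \<in> V" by auto
    then have "v' = v" using inj_onD[OF f *(2)] Suc.prems by simp
    moreover have "\<alpha> \<in> map c ` mers E l u" using *(4) Suc.IH[OF \<open>u \<in> V\<close>] by simp
    ultimately show "x \<in> ?R" using *(1,3) by blast
  next
    fix x assume "x \<in> ?R"
    then obtain u a \<alpha> where *: "(u, v, a) \<in> E" "x = c a # \<alpha>" "\<alpha> \<in> map c ` mers E l u"
      by blast
    from *(1) E have "u \<in> V" by auto
    then have "\<alpha> \<in> mers ((\<lambda>(u, v, a). (f u, f v, c a)) ` E) l (f u)" using *(3) Suc.IH[OF \<open>u \<in> V\<close>] by simp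
    moreover have "(f u, f v, c a) \<in> (\<lambda>(u, v, a). (f u, f v, c a)) ` E" using *(1) by force
    ultimately show "x \<in> ?L" unfolding mers.simps extensions_def using *(2) by blast
  qed
  also have "\<dots> = map c ` mers E (Suc l) v"
  proof (intro equalityI subsetI)
    fix x assume "x \<in> ?R"
    then obtain u a \<alpha> where "(u, v, a) \<in> E" "x = map c (a # \<alpha>)" "\<alpha> \<in> mers E l u" by auto
    then show "x \<in> map c ` mers E (Suc l) v" unfolding mers.simps extensions_def by blast
  next
    fix x assume "x \<in> map c ` mers E (Suc l) v"
    then obtain u a \<alpha> where "(u, v, a) \<in> E" "x = map c (a # \<alpha>)" "\<alpha> \<in> mers E l u"
      unfolding mers.simps extensions_def by blast
    then show "x \<in> ?R" by auto
  qed
  finally show ?case .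
qed simp

lemma card_mers_encode:
  assumes E: "E \<subseteq> V \<times> V \<times> A" and f: "inj_on f V" and c: "inj_on c A"
  shows "card (\<Union>x\<in>f ` V. mers ((\<lambda>(u, v, a). (f u, f v, c a)) ` E) l x) = card (kmers A V E l)"
proof -
  have "(\<Union>x\<in>f ` V. mers ((\<lambda>(u, v, a). (f u, f v, c a)) ` E) l x) =
      map c ` (\<Union>v\<in>V. mers E l v)"
    by (simp add: image_UN mers_encode[OF E f])
  moreover have "(\<Union>v\<in>V. mers E l v) \<subseteq> lists A" using mers_lists[OF E] by blast
  then have "inj_on (map c) (\<Union>v\<in>V. mers E l v)"
    by (intro inj_on_mapI inj_on_subset[OF c]) (auto simp: in_lists_conv_set)
  ultimately show ?thesis
    by (simp add: kmers_eq_mers[OF E] card_image inj_on_def)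
qed

section \<open>Stable bucket sorting and the order of the edges\<close>

definition bucket :: "('e \<Rightarrow> 'x) \<Rightarrow> 'x list \<Rightarrow> 'e list \<Rightarrow> 'e list" where
  "bucket key vs es = concat (map (\<lambda>x. filter (\<lambda>e. key e = x) es) vs)"

lemma set_bucket: "key ` set es \<subseteq> set vs \<Longrightarrow> set (bucket key vs es) = set es"
  by (auto simp: bucket_def)

lemma distinct_bucket:
  "distinct vs \<Longrightarrow> distinct es \<Longrightarrow> distinct (bucket key vs es)"
  by (induction vs) (auto simp: bucket_def)

lemma length_bucket:
  "distinct vs \<Longrightarrow> distinct es \<Longrightarrow> key ` set es \<subseteq> set vs \<Longrightarrow> length (bucket key vs es) = length es"
  using set_bucket[of key es vs] distinct_bucket[of vs es key] by (metis distinct_card)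

text \<open>By stability, \<open>R\<close> survives inside each bucket. Taking the result of one
  pass as \<open>R\<close> for the next gives the lexicographic order of a radix sort.\<close>

lemma sorted_wrt_bucket:
  assumes "sorted_wrt (\<lambda>x y. rk x < rk y) vs" "sorted_wrt R es"
  shows "sorted_wrt (\<lambda>d e. rk (key d) < rk (key e) \<or> key d = key e \<and> R d e) (bucket key vs es)"
  using assms(1)
proof (induction vs)
  case (Cons x vs)
  have "sorted_wrt (\<lambda>d e. rk (key d) < rk (key e) \<or> key d = key e \<and> R d e)
      (filter (\<lambda>e. key e = x) es)"
    by (rule sorted_wrt_mono_rel[OF _ sorted_wrt_filter[OF assms(2)]]) simp
  with Cons show ?case by (auto simp: bucket_def sorted_wrt_append)
qed (simp add: bucket_def)

text \<open>
  Labels are words of arbitrary size and cannot be bucket sorted; the Wheeler order makes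
  sorting by target and source equivalent to sorting by label and source. Determinism excludes
  two edges with the same label from one source.
\<close>

lemma wheeler_sorted_edges:
  fixes E :: "('v, 'a::linorder) edge set"
  assumes E: "E \<subseteq> V \<times> V \<times> A" and det: "deterministic E" and wh: "wheeler_order V E r"
    and rk: "\<And>u v. u \<in> V \<Longrightarrow> v \<in> V \<Longrightarrow> rk u < rk v \<longleftrightarrow> (u, v) \<in> r"
    and e: "(u, v, a) \<in> E" "(u', v', a') \<in> E" "(u, v, a) \<noteq> (u', v', a')"
    and less: "rk v < rk v' \<or> v = v' \<and> (rk u < rk u' \<or> u = u')"
  shows "a \<le> a' \<and> rk v \<le> (rk v' :: nat) \<and> (a = a' \<longrightarrow> rk u < rk u')"
proof -
  have V: "u \<in> V" "v \<in> V" "u' \<in> V" "v' \<in> V" using E e by auto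
  have W1: "rk v < rk v'" if "(u, v, a) \<in> E" "(u', v', a') \<in> E" "a < a'" for u v a u' v' a'
    using that wh E rk[of v v'] unfolding wheeler_order_def by blast
  have W2: "v = v' \<or> rk v < rk v'"
    if "(u, v, a) \<in> E" "(u', v', a) \<in> E" "rk u < rk u'" for u v a u' v'
    using that wh E rk[of v v'] rk[of u u'] unfolding wheeler_order_def by blast
  have total: "rk x < rk y \<or> rk y < rk x \<or> x = y" if "x \<in> V" "y \<in> V" for x y
    using that wh rk unfolding wheeler_order_def strict_linear_order_on_def total_on_def by blast
  have "a \<le> a'"
  proof (rule ccontr)
    assume "\<not> a \<le> a'"
    then have "rk v' < rk v" using W1[OF e(2,1)] by simp
    with less show False by auto
  qed
  moreover have "rk u < rk u'" if "a = a'"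
    using less
  proof
    assume vv: "rk v < rk v'"
    have "u \<noteq> u'" using vv det e that unfolding deterministic_def by blast
    moreover have "\<not> rk u' < rk u" using W2[of u' v' a u v] vv e that by auto
    ultimately show ?thesis using total V by blast
  qed (use e that in auto)
  moreover have "rk v \<le> rk v'" using less by auto
  ultimately show ?thesis by blast
qed

section \<open>The program\<close>

fun chain :: "(nat \<Rightarrow> nat) \<Rightarrow> nat \<Rightarrow> nat list \<Rightarrow> bool" where
  "chain nx h [] \<longleftrightarrow> h = 0"
| "chain nx h (e # es) \<longleftrightarrow> h = e \<and> e \<noteq> 0 \<and> chain nx (nx e) es"

lemma chain_upd [simp]: "e \<notin> set es \<Longrightarrow> chain (nx(e := y)) h es \<longleftrightarrow> chain nx h es"
  by (induction es arbitrary: h) auto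

text \<open>
  Registers: 0 the counter \<open>c\<close>, 20 and 2 the numbers of nodes and edges, 3 the length \<open>k\<close>, 4 and 5
  the constants 0 and 1, 11 the round, 12 and 13 the values \<open>la\<close> and \<open>lr\<close>. Arrays: 0, 3, 6 the
  edges in input order, sorted by source, and sorted by target and source; 1, 2 and 4, 5 the heads
  and links of the buckets of the two sorting passes; 7, 8 the values \<open>lo\<close> and \<open>hi\<close>, and 9, 10 those
  of the next round.
\<close>

definition identity_prog :: com where
  "identity_prog =
     Plus 6 4 4 ;;
     While (Less 6 2) (Plus 7 6 5 ;; Put 0 6 7 ;; Plus 6 7 4)"

text \<open>Inserting at the head of a list reverses the order, so the edges are visited backwards.
  This makes the sort stable.\<close>

definition link_prog :: "nat \<Rightarrow> nat \<Rightarrow> nat \<Rightarrow> nat \<Rightarrow> com" where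
  "link_prog K S H X =
     Plus 6 2 4 ;;
     While (Less 4 6)
       (Minus 6 6 5 ;; Get 7 S 6 ;; Get 8 K 7 ;; Get 9 H 8 ;; Put X 7 9 ;; Put H 8 7)"

definition gather_prog :: "nat \<Rightarrow> nat \<Rightarrow> nat \<Rightarrow> com" where
  "gather_prog H X D =
     Plus 10 4 4 ;; Plus 6 4 4 ;;
     While (Less 6 20)
       (Get 8 16 6 ;; Get 7 H 8 ;;
        While (Less 4 7) (Put D 10 7 ;; Plus 10 10 5 ;; Get 7 X 7) ;;
        Plus 6 6 5)"

text \<open>Intervals of the empty string: \<open>hi\<close> becomes 1, and \<open>lo\<close> is
  still zero from the initial memory.\<close>

definition init_prog :: com where
  "init_prog = Plus 6 4 4 ;; While (Less 6 20) (Put 8 6 5 ;; Plus 6 6 5)"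

text \<open>Register 7 holds the edge, 8 its source \<open>u\<close>, 15 its target
  \<open>v\<close>, 14 its label, 9 and 10 the values \<open>hi u\<close> and \<open>lo u\<close>,
  16 their difference, 17 \<open>lo u + 1\<close>, and 18 the old \<open>hi' v\<close>. Register 0
  passes from \<open>c\<close> through \<open>c0\<close> to \<open>c1\<close>.\<close>

definition process_prog :: com where
  "process_prog =
     Get 7 6 6 ;; Get 8 17 7 ;; Get 9 8 8 ;;
     Cond (Less 4 9)
       (Get 10 7 8 ;; Get 15 18 7 ;; Get 14 19 7 ;; Minus 16 9 10 ;; Plus 17 10 5 ;;
        Cond (Equal 14 12) (Cond (Equal 17 13) (Minus 0 0 5) Skip) Skip ;;
        Get 18 10 15 ;; Cond (Equal 18 4) (Put 9 15 0) Skip ;;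
        Plus 0 0 16 ;; Put 10 15 0 ;; Plus 12 14 4 ;; Plus 13 9 4)
       Skip ;;
     Plus 6 6 5"

definition pass_prog :: com where
  "pass_prog =
     Plus 0 4 4 ;; Plus 12 4 4 ;; Plus 13 4 4 ;; Plus 6 4 4 ;;
     While (Less 6 2) process_prog"

definition copy_prog :: com where
  "copy_prog =
     Plus 6 4 4 ;;
     While (Less 6 20)
       (Get 7 9 6 ;; Put 7 6 7 ;; Get 7 10 6 ;; Put 8 6 7 ;; Put 10 6 4 ;; Plus 6 6 5)"

definition rounds_prog :: com where
  "rounds_prog = Plus 11 4 4 ;; While (Less 11 3) (pass_prog ;; copy_prog ;; Plus 11 11 5)"

text \<open>The test for an empty node set is required by the time bound, which is then constant,
  while the rounds would still take time proportional to \<open>k\<close>. Register 0 is left at its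
  initial value 0, the correct answer.\<close>

definition main_prog :: com where
  "main_prog =
     SetC 5 1 ;;
     Cond (Less 4 20)
       (identity_prog ;; link_prog 17 0 1 2 ;; gather_prog 1 2 3 ;;
        link_prog 18 3 4 5 ;; gather_prog 4 5 6 ;; init_prog ;; rounds_prog)
       Skip"

section \<open>Correctness and running time of the pieces of the program\<close>

context layout
begin

lemma small: "nv + ne + 1 < 2 ^ w"
proof -
  have "nv + ne + 1 < 20 * (nv + ne) + 20" by simp
  also note word_size
  finally show ?thesis .
qed

definition const_regs :: "nat \<Rightarrow> (nat \<Rightarrow> nat) \<Rightarrow> bool" where
  "const_regs k r \<longleftrightarrow> r 20 = nv \<and> r 2 = ne \<and> r 3 = k \<and> r 4 = 0 \<and> r 5 = 1"

lemma const_regs_upd [simp]: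
  "d \<notin> {20, 2, 3, 4, 5} \<Longrightarrow> const_regs k (r(d := x)) \<longleftrightarrow> const_regs k r"
  by (auto simp: const_regs_def)

lemma const_regsD:
  assumes "const_regs k r"
  shows "r 20 = nv" "r 2 = ne" "r 3 = k" "r 4 = 0" "r 5 = 1"
  using assms by (simp_all add: const_regs_def)

lemma wp_identity:
  assumes r: "const_regs k r"
    and Q: "\<And>r' g' t'. const_regs k r' \<Longrightarrow> \<forall>j. j \<noteq> 0 \<longrightarrow> g' j = g j \<Longrightarrow>
      \<forall>p<ne. g' 0 p = p + 1 \<Longrightarrow> t' \<le> t + 20 * (nv + ne + 1) \<Longrightarrow> Q r' g' t'"
  shows "wp identity_prog Q r g t"
proof -
  \<comment> \<open>The 10 consists of 8 for the body, 1 for the test and 1 for the jump back; the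
    factors in the later invariants arise likewise.\<close>
  define I where "I i r' g' t' \<longleftrightarrow> r' 6 = i \<and> const_regs k r' \<and> (\<forall>j. j \<noteq> 0 \<longrightarrow> g' j = g j) \<and>
      (\<forall>p<i. g' 0 p = p + 1) \<and> t' = t + 1 + 10 * i" for i r' g' and t' :: nat
  have "wp (While (Less 6 2) (Plus 7 6 5 ;; Put 0 6 7 ;; Plus 6 7 4)) Q (r(6 := 0)) g (t + 1)"
  proof (rule wp_While_count[where I = I and n = ne])
    show "I 0 (r(6 := 0)) g (t + 1)" using r by (simp add: I_def const_regsD)
  next
    fix i r g t assume i: "i < ne" and inv: "I i r g t"
    then have regs: "const_regs k r" by (simp add: I_def)
    from i inv show "test (Less 6 2) r \<and> wp (Plus 7 6 5 ;; Put 0 6 7 ;; Plus 6 7 4)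
      (\<lambda>r g t. I (Suc i) r g (t + 1)) r g (t + 1)"
      using small by (auto simp: I_def const_regsD[OF regs] regs valid_def less_Suc_eq)
  next
    fix r' g' t' assume inv: "I ne r' g' t'"
    then have regs: "const_regs k r'" by (simp add: I_def)
    from inv show "\<not> test (Less 6 2) r' \<and> Q r' g' (t' + 2)"
      by (simp add: I_def const_regsD[OF regs] Q)
  qed
  then show ?thesis using small const_regsD[OF r] by (simp add: identity_prog_def)
qed

lemma wp_link:
  assumes r: "const_regs k r" and K: "K = 17 \<or> K = 18" and arr: "S < 16" "H < 16" "X < 16"
      "S \<noteq> H" "S \<noteq> X" "H \<noteq> X"
    and src: "length src = ne" "distinct src" "set src = {1..ne}" "\<forall>p<ne. g S p = src ! p"
    and H0: "\<forall>x. g H x = 0" and key: "\<forall>e\<in>{1..ne}. g K e < nv"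
    and Q: "\<And>r' g' t'. const_regs k r' \<Longrightarrow> \<forall>j. j \<noteq> H \<and> j \<noteq> X \<longrightarrow> g' j = g j \<Longrightarrow>
      \<forall>x. chain (g' X) (g' H x) (filter (\<lambda>e. g K e = x) src) \<Longrightarrow>
      t' \<le> t + 40 * (nv + ne + 1) \<Longrightarrow> Q r' g' t'"
  shows "wp (link_prog K S H X) Q r g t"
proof -
  define I where "I i r' g' t' \<longleftrightarrow> r' 6 = ne - i \<and> const_regs k r' \<and>
      (\<forall>j. j \<noteq> H \<and> j \<noteq> X \<longrightarrow> g' j = g j) \<and>
      (\<forall>x. chain (g' X) (g' H x) (filter (\<lambda>e. g K e = x) (drop (ne - i) src))) \<and>
      t' = t + 1 + 33 * i" for i r' g' and t' :: nat
  let ?body = "Minus 6 6 5 ;; Get 7 S 6 ;; Get 8 K 7 ;; Get 9 H 8 ;; Put X 7 9 ;; Put H 8 7"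
  have "wp (While (Less 4 6) ?body) Q (r(6 := ne)) g (t + 1)"
  proof (rule wp_While_count[where I = I and n = ne])
    show "I 0 (r(6 := ne)) g (t + 1)" using r src H0 by (simp add: I_def const_regsD)
  next
    fix i r' g' t' assume i: "i < ne" and inv: "I i r' g' t'"
    then have regs: "const_regs k r'" by (simp add: I_def)
    define p where "p = ne - Suc i"
    define e where "e = src ! p"
    have p: "p < ne" "ne - i = Suc p" using i by (auto simp: p_def)
    then have e: "e \<in> {1..ne}" using src by (auto simp: e_def)
    have drop: "drop p src = e # drop (Suc p) src"
      using p src by (simp add: Cons_nth_drop_Suc e_def)
    have e_notin: "e \<notin> set (drop (Suc p) src)"
      using src(2) distinct_drop[of src p] unfolding drop by simp
    define x where "x = g K e"
    have x: "x < nv" using key e by (simp add: x_def)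
    have g': "g' S p = e" "g' K e = x" using inv arr K src p by (auto simp: I_def e_def x_def)
    have old: "chain (g' X) (g' H y) (filter (\<lambda>e. g K e = y) (drop (Suc p) src))" for y
      using inv p by (simp add: I_def)
    \<comment> \<open>The two stores put \<open>e\<close> in front of list \<open>x\<close>. Since
      \<open>e\<close> occurs in no list yet, changing its link leaves all other lists
      intact.\<close>
    have "chain ((g' X)(e := g' H x)) (((g' H)(x := e)) y) (filter (\<lambda>e. g K e = y) (drop p src))"
      for y
      using old[of y] e_notin e unfolding drop by (auto simp: x_def)
    then show "test (Less 4 6) r' \<and> wp ?body (\<lambda>r g t. I (Suc i) r g (t + 1)) r' g' (t' + 1)"
      using inv e x p arr g' disjE[OF K, of "17 \<le> K \<and> K < 20"]
      by (simp add: I_def const_regsD[OF regs] regs valid_def p_def[symmetric])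
  next
    fix r' g' t' assume inv: "I ne r' g' t'"
    then have regs: "const_regs k r'" by (simp add: I_def)
    from inv show "\<not> test (Less 4 6) r' \<and> Q r' g' (t' + 2)"
      by (simp add: I_def const_regsD[OF regs] Q)
  qed
  then show ?thesis using small const_regsD[OF r] by (simp add: link_prog_def)
qed

lemma wp_gather:
  assumes r: "const_regs k r" and arr: "D < 16" "H < 16" "X < 16" "D \<noteq> H" "D \<noteq> X"
    and vs: "length vs = nv" "\<forall>i<nv. g 16 i = vs ! i" "set vs \<subseteq> {..<nv}"
    and chain: "\<forall>x. chain (g X) (g H x) (B x)" and B: "\<forall>x. set (B x) \<subseteq> {1..ne}"
    and len: "length (concat (map B vs)) = ne"
    and Q: "\<And>r' g' t'. const_regs k r' \<Longrightarrow> \<forall>j. j \<noteq> D \<longrightarrow> g' j = g j \<Longrightarrow>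
      \<forall>p<ne. g' D p = concat (map B vs) ! p \<Longrightarrow>
      t' \<le> t + 40 * (nv + ne + 1) \<Longrightarrow> Q r' g' t'"
  shows "wp (gather_prog H X D) Q r g t"
proof -
  define out where "out i = concat (map B (take i vs))" for i
  have out_Suc: "out (Suc i) = out i @ B (vs ! i)" if "i < nv" for i
    using that vs by (simp add: out_def take_Suc_conv_app_nth)
  have out_le: "length (out i) \<le> ne" for i
  proof -
    have "concat (map B vs) = out i @ concat (map B (drop i vs))"
      unfolding out_def by (metis append_take_drop_id concat_append map_append)
    then show ?thesis using len by simp
  qed
  \<comment> \<open>Time is charged separately, 17 per node and 15 per gathered edge, which keeps
    the nested loops linear.\<close>
  define I where "I i r' g' t' \<longleftrightarrow> r' 6 = i \<and> r' 10 = length (out i) \<and> const_regs k r' \<and>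
      (\<forall>j. j \<noteq> D \<longrightarrow> g' j = g j) \<and> (\<forall>p<length (out i). g' D p = out i ! p) \<and>
      t' = t + 2 + 17 * i + 15 * length (out i)" for i r' g' and t' :: nat
  let ?inner = "Put D 10 7 ;; Plus 10 10 5 ;; Get 7 X 7"
  let ?body = "Get 8 16 6 ;; Get 7 H 8 ;; While (Less 4 7) ?inner ;; Plus 6 6 5"
  have "wp (While (Less 6 20) ?body) Q (r(10 := 0, 6 := 0)) g (t + 2)"
  proof (rule wp_While_count[where I = I and n = nv])
    show "I 0 (r(10 := 0, 6 := 0)) g (t + 2)" using r by (simp add: I_def out_def)
  next
    fix i r1 g1 t1 assume i: "i < nv" and inv: "I i r1 g1 t1"
    then have regs1: "const_regs k r1" by (simp add: I_def)
    define x where "x = vs ! i"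
    have x: "x < nv" using i vs nth_mem[of i vs] unfolding x_def by blast
    have out_x: "out (Suc i) = out i @ B x" using out_Suc i by (simp add: x_def)
    then have len_x: "length (out i) + length (B x) \<le> ne" using out_le[of "Suc i"] by simp
    define J where "J n r' g' t' \<longleftrightarrow> r' 6 = i \<and> r' 10 = length (out i) + n \<and> const_regs k r' \<and>
      chain (g X) (r' 7) (drop n (B x)) \<and>
      (\<forall>j. j \<noteq> D \<longrightarrow> g' j = g j) \<and>
      (\<forall>p<length (out i) + n. g' D p = (out i @ B x) ! p) \<and>
      t' = t1 + 13 + 15 * n" for n r' g' and t' :: nat
    have "wp (While (Less 4 7) ?inner) (wp (Plus 6 6 5) (\<lambda>r g t. I (Suc i) r g (t + 1)))
        (r1(8 := x, 7 := g H x)) g1 (t1 + 13)"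
    proof (rule wp_While_count[where I = J and n = "length (B x)"])
      show "J 0 (r1(8 := x, 7 := g H x)) g1 (t1 + 13)"
        using inv chain by (simp add: I_def J_def nth_append)
    next
      fix n r' g' t' assume n: "n < length (B x)" and J: "J n r' g' t'"
      then have regs: "const_regs k r'" by (simp add: J_def)
      define e where "e = B x ! n"
      have "drop n (B x) = e # drop (Suc n) (B x)"
        using n by (simp add: Cons_nth_drop_Suc e_def)
      moreover have "e \<in> {1..ne}" using n B nth_mem[of n "B x"] unfolding e_def by blast
      moreover have "(out i @ B x) ! (length (out i) + n) = e" by (simp add: nth_append e_def)
      ultimately show "test (Less 4 7) r' \<and> wp ?inner (\<lambda>r g t. J (Suc n) r g (t + 1)) r' g' (t' + 1)"
        using J arr len_x n small
        by (auto simp: J_def const_regsD[OF regs] regs valid_def less_Suc_eq)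
    next
      fix r' g' t' assume J: "J (length (B x)) r' g' t'"
      then have regs: "const_regs k r'" by (simp add: J_def)
      from J show "\<not> test (Less 4 7) r' \<and> wp (Plus 6 6 5) (\<lambda>r g t. I (Suc i) r g (t + 1)) r' g' (t' + 2)"
        using i small inv by (auto simp: I_def J_def const_regsD[OF regs] regs out_x)
    qed
    moreover have "g1 16 i = x" "g1 H = g H" using inv arr i vs by (auto simp: I_def x_def)
    ultimately show "test (Less 6 20) r1 \<and> wp ?body (\<lambda>r g t. I (Suc i) r g (t + 1)) r1 g1 (t1 + 1)"
      using inv i x arr by (auto simp: I_def const_regsD[OF regs1] valid_def)
  next
    fix r' g' t' assume inv: "I nv r' g' t'"
    then have regs: "const_regs k r'" by (simp add: I_def)
    have "out nv = concat (map B vs)" using vs by (simp add: out_def)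
    with inv len show "\<not> test (Less 6 20) r' \<and> Q r' g' (t' + 2)"
      by (simp add: I_def const_regsD[OF regs] Q)
  qed
  then show ?thesis using small const_regsD[OF r] by (simp add: gather_prog_def)
qed

lemma wp_init:
  assumes r: "const_regs k r"
    and Q: "\<And>r' g' t'. const_regs k r' \<Longrightarrow> \<forall>j. j \<noteq> 8 \<longrightarrow> g' j = g j \<Longrightarrow>
      \<forall>x<nv. g' 8 x = 1 \<Longrightarrow> t' \<le> t + 20 * (nv + ne + 1) \<Longrightarrow> Q r' g' t'"
  shows "wp init_prog Q r g t"
proof -
  define I where "I i r' g' t' \<longleftrightarrow> r' 6 = i \<and> const_regs k r' \<and> (\<forall>j. j \<noteq> 8 \<longrightarrow> g' j = g j) \<and>
      (\<forall>x<i. g' 8 x = 1) \<and> t' = t + 1 + 9 * i" for i r' g' and t' :: nat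
  have "wp (While (Less 6 20) (Put 8 6 5 ;; Plus 6 6 5)) Q (r(6 := 0)) g (t + 1)"
  proof (rule wp_While_count[where I = I and n = nv])
    show "I 0 (r(6 := 0)) g (t + 1)" using r by (simp add: I_def const_regsD)
  next
    fix i r g t assume i: "i < nv" and inv: "I i r g t"
    then have regs: "const_regs k r" by (simp add: I_def)
    from i inv show "test (Less 6 20) r \<and> wp (Put 8 6 5 ;; Plus 6 6 5)
      (\<lambda>r g t. I (Suc i) r g (t + 1)) r g (t + 1)"
      using small by (auto simp: I_def const_regsD[OF regs] regs valid_def less_Suc_eq)
  next
    fix r' g' t' assume inv: "I nv r' g' t'"
    then have regs: "const_regs k r'" by (simp add: I_def)
    from inv show "\<not> test (Less 6 20) r' \<and> Q r' g' (t' + 2)"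
      by (simp add: I_def const_regsD[OF regs] Q)
  qed
  then show ?thesis using small const_regsD[OF r] by (simp add: init_prog_def)
qed

lemma wp_copy:
  assumes r: "const_regs k r" 
    and Q: "\<And>r' g' t'. const_regs k r' \<Longrightarrow> r' 0 = r 0 \<Longrightarrow> r' 11 = r 11 \<Longrightarrow>
      \<forall>j. j \<noteq> 7 \<and> j \<noteq> 8 \<and> j \<noteq> 10 \<longrightarrow> g' j = g j \<Longrightarrow>
      \<forall>x<nv. g' 7 x = g 9 x \<and> g' 8 x = g 10 x \<and> g' 10 x = 0 \<Longrightarrow>
      t' \<le> t + 40 * (nv + ne + 1) \<Longrightarrow> Q r' g' t'"
  shows "wp copy_prog Q r g t"
proof -
  define I where "I i r' g' t' \<longleftrightarrow> r' 6 = i \<and> const_regs k r' \<and> r' 0 = r 0 \<and> r' 11 = r 11 \<and>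
      (\<forall>j. j \<noteq> 7 \<and> j \<noteq> 8 \<and> j \<noteq> 10 \<longrightarrow> g' j = g j) \<and>
      (\<forall>x<i. g' 7 x = g 9 x \<and> g' 8 x = g 10 x \<and> g' 10 x = 0) \<and>
      (\<forall>x\<ge>i. g' 10 x = g 10 x) \<and> t' = t + 1 + 33 * i" for i r' g' and t' :: nat
  let ?body = "Get 7 9 6 ;; Put 7 6 7 ;; Get 7 10 6 ;; Put 8 6 7 ;; Put 10 6 4 ;; Plus 6 6 5"
  have "wp (While (Less 6 20) ?body) Q (r(6 := 0)) g (t + 1)"
  proof (rule wp_While_count[where I = I and n = nv])
    show "I 0 (r(6 := 0)) g (t + 1)" using r by (simp add: I_def const_regsD)
  next
    fix i r g t assume i: "i < nv" and inv: "I i r g t"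
    then have regs: "const_regs k r" by (simp add: I_def)
    from i inv show "test (Less 6 20) r \<and> wp ?body (\<lambda>r g t. I (Suc i) r g (t + 1)) r g (t + 1)"
      using small by (auto simp: I_def const_regsD[OF regs] regs valid_def less_Suc_eq)
  next
    fix r' g' t' assume inv: "I nv r' g' t'"
    then have regs: "const_regs k r'" by (simp add: I_def)
    from inv show "\<not> test (Less 6 20) r' \<and> Q r' g' (t' + 2)"
      by (simp add: I_def const_regsD[OF regs] Q)
  qed
  then show ?thesis using small const_regsD[OF r] by (simp add: copy_prog_def)
qed

text \<open>The assumptions \<open>bound\<close> and \<open>pos\<close> concern every prefix of the
  scan: they exclude overflow of the counter and a decrement below zero. Both come from the round
  invariant through \<open>round_state\<close>.\<close>

lemma wp_pass:
  fixes g :: "nat \<Rightarrow> nat \<Rightarrow> nat" and srt :: "nat list"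
  defines "edge e \<equiv> (g 17 e, g 18 e, g 19 e)"
  defines "st p \<equiv> fold (process (g 7) (g 8)) (map edge (take p srt)) (0, 0, 0, g 9, g 10)"
  assumes r: "const_regs k r"
    and srt: "length srt = ne" "set srt \<subseteq> {1..ne}" "\<forall>p<ne. g 6 p = srt ! p"
    and nodes: "\<forall>e\<in>{1..ne}. g 17 e < nv \<and> g 18 e < nv"
    and labels: "\<forall>e\<in>{1..ne}. g 19 e < 2 ^ w"
    and ranks: "\<forall>x<nv. g 8 x \<noteq> 0 \<longrightarrow> g 7 x < g 8 x \<and> g 8 x < 2 ^ w"
    and bound: "\<forall>p\<le>ne. fst (st p) < 2 ^ w"
    and pos: "\<forall>p\<le>ne. fst (snd (snd (st p))) \<noteq> 0 \<longrightarrow> fst (st p) \<noteq> 0"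
    and Q: "\<And>r' g' t'. const_regs k r' \<Longrightarrow> r' 11 = r 11 \<Longrightarrow>
      \<forall>j. j \<noteq> 9 \<and> j \<noteq> 10 \<longrightarrow> g' j = g j \<Longrightarrow>
      st ne = (r' 0, r' 12, r' 13, g' 9, g' 10) \<Longrightarrow>
      t' \<le> t + 80 * (nv + ne + 1) \<Longrightarrow> Q r' g' t'"
  shows "wp pass_prog Q r g t"
proof -
  define I where "I p r' g' t' \<longleftrightarrow> r' 6 = p \<and> const_regs k r' \<and> r' 11 = r 11 \<and>
      (\<forall>j. j \<noteq> 9 \<and> j \<noteq> 10 \<longrightarrow> g' j = g j) \<and>
      st p = (r' 0, r' 12, r' 13, g' 9, g' 10) \<and>
      t' \<le> t + 4 + 70 * p" for p r' g' and t' :: nat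
  have "wp (While (Less 6 2) process_prog) Q (r(0 := 0, 12 := 0, 13 := 0, 6 := 0)) g (t + 4)"
  proof (rule wp_While_count[where I = I and n = ne])
    show "I 0 (r(0 := 0, 12 := 0, 13 := 0, 6 := 0)) g (t + 4)"
      using r by (simp add: I_def st_def)
  next
    fix p r' g' t' assume p: "p < ne" and inv: "I p r' g' t'"
    then have regs: "const_regs k r'" by (simp add: I_def)
    define e where "e = srt ! p"
    define u v a where "u = g 17 e" and "v = g 18 e" and "a = g 19 e"
    have e: "1 \<le> e" "e \<le> ne" using p srt by (auto simp: e_def dest!: nth_mem)
    then have uva: "u < nv" "v < nv" "a < 2 ^ w"
      using nodes labels by (auto simp: u_def v_def a_def)
    have g': "g' 6 p = e" "g' 17 e = u" "g' 18 e = v" "g' 19 e = a" "g' 7 = g 7" "g' 8 = g 8"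
      using inv srt p by (auto simp: I_def e_def u_def v_def a_def)
    have "st (Suc p) = process (g 7) (g 8) (edge e) (st p)"
      using p srt(1) by (simp add: st_def take_Suc_conv_app_nth e_def)
    then have st_Suc: "st (Suc p) =
        process (g 7) (g 8) (u, v, a) (r' 0, r' 12, r' 13, g' 9, g' 10)"
      using inv by (simp add: I_def edge_def u_def v_def a_def)
    have le: "g 8 u \<noteq> 0 \<Longrightarrow> g 7 u < g 8 u" "g 8 u < 2 ^ w" using ranks uva by force+
    have "fst (st (Suc p)) < 2 ^ w" using bound p by simp
    moreover have "r' 13 \<noteq> 0 \<longrightarrow> r' 0 \<noteq> 0" using pos[rule_format, of p] p inv by (simp add: I_def)
    moreover have "r' 6 = p" "r' 11 = r 11" "\<forall>j. j \<noteq> 9 \<and> j \<noteq> 10 \<longrightarrow> g' j = g j"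
        "t' \<le> t + 4 + 70 * p"
      using inv by (simp_all add: I_def)
    ultimately show "test (Less 6 2) r' \<and>
        wp process_prog (\<lambda>r g t. I (Suc p) r g (t + 1)) r' g' (t' + 1)"
      using p e uva le small g' st_Suc
      by (cases "g 8 u = 0"; cases "a = r' 12"; cases "g 7 u + 1 = r' 13"; cases "g' 10 v = 0")
        (simp_all add: process_prog_def I_def const_regsD[OF regs] regs valid_def process_def Let_def)
  next
    fix r' g' t' assume inv: "I ne r' g' t'"
    then have regs: "const_regs k r'" by (simp add: I_def)
    from inv show "\<not> test (Less 6 2) r' \<and> Q r' g' (t' + 2)"
      by (simp add: I_def const_regsD[OF regs] Q)
  qed
  then show ?thesis using small const_regsD[OF r] by (simp add: pass_prog_def eval_nat_numeral)
qed

end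

text \<open>The instance as the machine sees it: edges are numbers and labels are words. Determinism
  and the Wheeler conditions on edges enter only through \<open>less\<close>.\<close>

locale wheeler_input = layout w nv ne + ranked_nodes "{..<nv}" rk
  for w nv ne :: nat and rk :: "nat \<Rightarrow> nat" +
  fixes ids :: "nat list" and src tgt lab :: "nat \<Rightarrow> nat" and k :: nat
  assumes ids: "length ids = nv" "distinct ids" "set ids = {..<nv}"
      "sorted_wrt (\<lambda>x y. rk x < rk y) ids"
    and ends: "\<And>e. e \<in> {1..ne} \<Longrightarrow> src e < nv \<and> tgt e < nv"
    and lab: "\<And>e. e \<in> {1..ne} \<Longrightarrow> lab e < 2 ^ w"
    and less: "\<And>d e. d \<in> {1..ne} \<Longrightarrow> e \<in> {1..ne} \<Longrightarrow> d \<noteq> e \<Longrightarrow>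
      rk (tgt d) < rk (tgt e) \<or> tgt d = tgt e \<and> (rk (src d) < rk (src e) \<or> src d = src e) \<Longrightarrow>
      edge_less (src d, tgt d, lab d) (src e, tgt e, lab e)"
    and k: "1 \<le> k" "k < 2 ^ w"
    and count: "\<And>l. 1 \<le> l \<Longrightarrow> l \<le> k \<Longrightarrow>
      card (\<Union>x<nv. mers ((\<lambda>e. (src e, tgt e, lab e)) ` {1..ne}) l x) < 2 ^ w"
begin

abbreviation "edge \<equiv> \<lambda>e. (src e, tgt e, lab e)"
abbreviation "edges \<equiv> edge ` {1..ne}"
abbreviation "mer_count l \<equiv> card (\<Union>x<nv. mers edges l x)"

definition "by_src = bucket src ids [1..<ne + 1]"
definition "by_tgt = bucket tgt ids by_src"

lemma by_src: "set by_src = {1..ne}" "distinct by_src" "length by_src = ne"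
proof -
  have *: "src ` set [1..<ne + 1] \<subseteq> set ids" using ends ids by auto
  show "set by_src = {1..ne}" 
    unfolding by_src_def set_bucket[OF *] by (simp add: atLeastLessThanSuc_atLeastAtMost del: upt_Suc)
  show "distinct by_src" unfolding by_src_def by (rule distinct_bucket[OF ids(2)]) simp
  show "length by_src = ne" unfolding by_src_def length_bucket[OF ids(2) distinct_upt *] by simp
qed

lemma by_tgt: "set by_tgt = {1..ne}" "length by_tgt = ne"
proof -
  have *: "tgt ` set by_src \<subseteq> set ids" using ends ids by (auto simp: by_src)
  show "set by_tgt = {1..ne}" using set_bucket[OF *] by (simp add: by_tgt_def by_src)
  show "length by_tgt = ne" using length_bucket[OF ids(2) _ *] by_src by (simp add: by_tgt_def)
qed

lemma sorted_by_tgt: "sorted_wrt edge_less (map edge by_tgt)"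
proof -
  \<comment> \<open>The input order of the edges is arbitrary and yields only distinctness; ties in
    target and source are left to \<open>less\<close>.\<close>
  have "sorted_wrt (\<noteq>) [1..<ne + 1]"
    using sorted_wrt_upt[of 1 "ne + 1"] by (rule sorted_wrt_mono_rel[rotated]) simp
  then have "sorted_wrt (\<lambda>d e. rk (tgt d) < rk (tgt e) \<or> tgt d = tgt e \<and>
      (rk (src d) < rk (src e) \<or> src d = src e \<and> d \<noteq> e)) by_tgt"
    unfolding by_tgt_def by_src_def by (intro sorted_wrt_bucket ids(4))
  then have "sorted_wrt (\<lambda>d e. edge_less (edge d) (edge e)) by_tgt"
  proof (rule sorted_wrt_mono_rel[rotated])
    fix d e assume "d \<in> set by_tgt" "e \<in> set by_tgt"
      "rk (tgt d) < rk (tgt e) \<or> tgt d = tgt e \<and>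
        (rk (src d) < rk (src e) \<or> src d = src e \<and> d \<noteq> e)"
    then show "edge_less (edge d) (edge e)"
      using less[of d e] by (auto simp: by_tgt)
  qed
  then show ?thesis by (simp add: sorted_wrt_map)
qed

lemma edges_subset: "set (map edge by_tgt) = edges" "edges \<subseteq> {..<nv} \<times> {..<nv} \<times> UNIV"
  using ends by (auto simp: by_tgt)

definition loaded :: "(nat \<Rightarrow> nat \<Rightarrow> nat) \<Rightarrow> bool" where
  "loaded g \<longleftrightarrow> (\<forall>i<nv. g 16 i = ids ! i) \<and> g 17 = src \<and> g 18 = tgt \<and> g 19 = lab"

text \<open>Besides the result of a round, this bounds the counter at every prefix \<open>p\<close>:
  it is the number of strings obtained from the edges scanned so far, a subset of those obtained
  from all edges.\<close>

lemma round_state: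
  fixes g :: "nat \<Rightarrow> nat \<Rightarrow> nat"
  defines "st p \<equiv> fold (process (g 7) (g 8)) (map edge (take p by_tgt)) (0, 0, 0, g 9, g 10)"
  assumes con: "consistent (mers edges j) M (g 7) (g 8)" and zero: "\<forall>x<nv. g 10 x = 0"
  shows "\<exists>M'. consistent (mers edges (Suc j)) M' (fst (snd (snd (snd (st ne)))))
      (snd (snd (snd (snd (st ne)))))"
    and "fst (st ne) = mer_count (Suc j)"
    and "p \<le> ne \<Longrightarrow> fst (st p) \<le> mer_count (Suc j)"
    and "p \<le> ne \<Longrightarrow> fst (snd (snd (st p))) \<noteq> 0 \<Longrightarrow> fst (st p) \<noteq> 0"
proof -
  have inv: "round_inv (mers edges j) M (g 7) (g 8) (edge ` set (take p by_tgt)) (st p)" for p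
    using round_inv_fold[OF con, of "map edge (take p by_tgt)" "g 10" 0 "g 9"]
      sorted_wrt_take[OF sorted_by_tgt, of p] edges_subset zero set_take_subset[of p by_tgt]
    by (auto simp: st_def take_map by_tgt simp del: set_map) (auto simp: by_tgt)
  have part: "\<exists>M'. length M' = fst (st p) \<and>
      consistent (extensions (edge ` set (take p by_tgt)) (mers edges j)) M'
        (fst (snd (snd (snd (st p))))) (snd (snd (snd (snd (st p)))))" for p
    using inv[of p] by (cases "st p") (auto simp: round_inv_def)
  have all: "edge ` set (take ne by_tgt) = edges" by (simp add: by_tgt)
  obtain M' where M': "length M' = fst (st ne)" "consistent (mers edges (Suc j)) M'
      (fst (snd (snd (snd (st ne))))) (snd (snd (snd (snd (st ne)))))"
    using part[of ne] unfolding all by auto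
  then show "\<exists>M'. consistent (mers edges (Suc j)) M' (fst (snd (snd (snd (st ne)))))
      (snd (snd (snd (snd (st ne)))))" by blast
  show full: "fst (st ne) = mer_count (Suc j)" using consistent_card[OF M'(2)] M'(1) by simp
  have fin: "finite (\<Union>x<nv. mers edges (Suc j) x)"
    using M'(2) unfolding consistent_def by (metis finite_set)
  show "fst (st p) \<le> mer_count (Suc j)" if "p \<le> ne"
  proof -
    obtain N where N: "length N = fst (st p)"
      "consistent (extensions (edge ` set (take p by_tgt)) (mers edges j)) N
        (fst (snd (snd (snd (st p))))) (snd (snd (snd (snd (st p)))))"
      using part by blast
    have "edge ` set (take p by_tgt) \<subseteq> edges"
      using set_take_subset[of p by_tgt] by_tgt by auto
    then have sub: "(\<Union>x<nv. extensions (edge ` set (take p by_tgt)) (mers edges j) x) \<subseteq>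
        (\<Union>x<nv. mers edges (Suc j) x)"
      unfolding mers.simps by (intro UN_mono extensions_mono) auto
    have "fst (st p) = card (\<Union>x<nv. extensions (edge ` set (take p by_tgt)) (mers edges j) x)"
      using consistent_card[OF N(2)] N(1) by simp
    also have "\<dots> \<le> mer_count (Suc j)" by (rule card_mono[OF fin sub])
    finally show ?thesis .
  qed
  show "fst (st p) \<noteq> 0" if "p \<le> ne" "fst (snd (snd (st p))) \<noteq> 0"
    using inv[of p] that by (cases "st p") (auto simp: round_inv_def)
qed

lemma wp_rounds:
  assumes r: "const_regs k r" and g: "loaded g" "\<forall>p<ne. g 6 p = by_tgt ! p"
    "\<forall>x<nv. g 7 x = 0" "\<forall>x<nv. g 8 x = 1" "\<forall>x<nv. g 10 x = 0" and "0 < nv"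
    and Q: "\<And>r' g' t'. r' 0 = mer_count k \<Longrightarrow>
      t' \<le> t + 3 + k * (200 * (nv + ne + 1)) \<Longrightarrow> Q r' g' t'"
  shows "wp rounds_prog Q r g t"
proof -
  define I where "I j r' g' t' \<longleftrightarrow> r' 11 = j \<and> const_regs k r' \<and> loaded g' \<and>
      (\<forall>p<ne. g' 6 p = by_tgt ! p) \<and> (\<exists>M. consistent (mers edges j) M (g' 7) (g' 8)) \<and>
      (\<forall>x<nv. g' 10 x = 0) \<and> (j \<noteq> 0 \<longrightarrow> r' 0 = mer_count j) \<and>
      t' \<le> t + 1 + j * (200 * (nv + ne + 1))" for j r' g' and t' :: nat
  have "wp (While (Less 11 3) (pass_prog ;; copy_prog ;; Plus 11 11 5)) Q (r(11 := 0)) g (t + 1)"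
  proof (rule wp_While_count[where I = I and n = k])
    have "consistent (mers edges 0) [[]] (g 7) (g 8)"
      using consistent_0[of edges] \<open>0 < nv\<close> g
        consistent_cong[of "g 7" "\<lambda>_. 0" "g 8" "\<lambda>_. 1"] by auto
    then show "I 0 (r(11 := 0)) g (t + 1)" using r g by (auto simp: I_def)
  next
    fix j r1 g1 t1 assume j: "j < k" and inv: "I j r1 g1 t1"
    then have regs1: "const_regs k r1" and loaded1: "loaded g1" by (simp_all add: I_def)
    from loaded1 have arr: "g1 17 = src" "g1 18 = tgt" "g1 19 = lab" by (simp_all add: loaded_def)
    obtain M where M: "consistent (mers edges j) M (g1 7) (g1 8)" using inv by (auto simp: I_def)
    have zero: "\<forall>x<nv. g1 10 x = 0" using inv by (simp add: I_def)
    note state = round_state[OF M zero]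
    \<comment> \<open>The stored values \<open>hi\<close> are at most \<open>mer_count j\<close>.
      The assumption \<open>count\<close> starts at length 1, so the empty string is treated
      apart.\<close>
    have "mer_count j < 2 ^ w"
    proof (cases "j = 0")
      case True
      have "mer_count 0 \<le> card {[] :: nat list}" by (intro card_mono) auto
      then show ?thesis using True small by simp
    next
      case False
      then show ?thesis using count[of j] j by simp
    qed
    have count_Suc: "mer_count (Suc j) < 2 ^ w" using count[of "Suc j"] j by simp
    from \<open>mer_count j < 2 ^ w\<close> have ranks: "\<forall>x<nv. g1 8 x \<noteq> 0 \<longrightarrow> g1 7 x < g1 8 x \<and> g1 8 x < 2 ^ w"
      using M consistent_card[OF M] unfolding consistent_def
      by (metis lessThan_iff order.strict_trans1)
    have "wp pass_prog (wp (copy_prog ;; Plus 11 11 5) (\<lambda>r g t. I (Suc j) r g (t + 1)))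
      r1 g1 (t1 + 1)"
    proof (rule wp_pass[OF regs1 by_tgt(2), where g = g1, unfolded arr, OF _ _ _ _ ranks])
      show "set by_tgt \<subseteq> {1..ne}" by (simp add: by_tgt)
      show "\<forall>p<ne. g1 6 p = by_tgt ! p" using inv by (simp add: I_def)
      show "\<forall>e\<in>{1..ne}. src e < nv \<and> tgt e < nv" using ends by blast
      show "\<forall>e\<in>{1..ne}. lab e < 2 ^ w" using lab by blast
      show "\<forall>p\<le>ne. fst (fold (process (g1 7) (g1 8)) (map edge (take p by_tgt))
          (0, 0, 0, g1 9, g1 10)) < 2 ^ w"
        using le_less_trans[OF state(3) count_Suc] by blast
      show "\<forall>p\<le>ne. fst (snd (snd (fold (process (g1 7) (g1 8)) (map edge (take p by_tgt))
          (0, 0, 0, g1 9, g1 10)))) \<noteq> 0 \<longrightarrow>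
          fst (fold (process (g1 7) (g1 8)) (map edge (take p by_tgt))
          (0, 0, 0, g1 9, g1 10)) \<noteq> 0"
        using state(4) by blast
    next
      fix r2 g2 t2
      assume 2: "const_regs k r2" "r2 11 = r1 11" "\<forall>j. j \<noteq> 9 \<and> j \<noteq> 10 \<longrightarrow> g2 j = g1 j"
        "fold (process (g1 7) (g1 8)) (map edge (take ne by_tgt)) (0, 0, 0, g1 9, g1 10) =
          (r2 0, r2 12, r2 13, g2 9, g2 10)"
        "t2 \<le> t1 + 1 + 80 * (nv + ne + 1)"
      have "wp copy_prog (wp (Plus 11 11 5) (\<lambda>r g t. I (Suc j) r g (t + 1))) r2 g2 t2"
      proof (rule wp_copy[OF 2(1)])
        fix r3 g3 t3
        assume 3: "const_regs k r3" "r3 0 = r2 0" "r3 11 = r2 11"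
          "\<forall>j. j \<noteq> 7 \<and> j \<noteq> 8 \<and> j \<noteq> 10 \<longrightarrow> g3 j = g2 j"
          "\<forall>x<nv. g3 7 x = g2 9 x \<and> g3 8 x = g2 10 x \<and> g3 10 x = 0"
          "t3 \<le> t2 + 40 * (nv + ne + 1)"
        have "\<exists>M. consistent (mers edges (Suc j)) M (g2 9) (g2 10)"
          using state(1) by (simp add: 2(4))
        then have con: "\<exists>M. consistent (mers edges (Suc j)) M (g3 7) (g3 8)"
          using 3(5) consistent_cong[of "g3 7" "g2 9" "g3 8" "g2 10"] by auto
        have res: "r3 0 = mer_count (Suc j)" using state(2) 3(2) by (simp add: 2(4))
        have "r3 11 = j" using 3 2 inv by (simp add: I_def)
        moreover have "loaded g3" using loaded1 2(3) 3(4) by (simp add: loaded_def)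
        moreover have "\<forall>p<ne. g3 6 p = by_tgt ! p" using inv 2(3) 3(4) by (simp add: I_def)
        moreover have "t1 \<le> t + 1 + j * (200 * (nv + ne + 1))" using inv by (simp add: I_def)
        \<comment> \<open>A round takes at most 80 + 40 units per element plus a constant; 200
          leaves room.\<close>
        then have "t3 + 2 \<le> t + 1 + Suc j * (200 * (nv + ne + 1))"
          using 2(5) 3(6) by (simp add: algebra_simps)
        moreover have "j + 1 < 2 ^ w" using j k by simp
        ultimately show "wp (Plus 11 11 5) (\<lambda>r g t. I (Suc j) r g (t + 1)) r3 g3 t3"
          using con res 3(1,5) by (simp add: I_def const_regsD[OF 3(1)])
      qed
      then show "wp (copy_prog ;; Plus 11 11 5) (\<lambda>r g t. I (Suc j) r g (t + 1)) r2 g2 t2"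
        by simp
    qed
    then show "test (Less 11 3) r1 \<and> wp (pass_prog ;; copy_prog ;; Plus 11 11 5)
        (\<lambda>r g t. I (Suc j) r g (t + 1)) r1 g1 (t1 + 1)"
      using j inv by (simp add: I_def const_regsD[OF regs1])
  next
    fix r' g' t' assume inv: "I k r' g' t'"
    then have regs: "const_regs k r'" by (simp add: I_def)
    from inv show "\<not> test (Less 11 3) r' \<and> Q r' g' (t' + 2)"
      using k by (auto simp: I_def const_regsD[OF regs] intro!: Q)
  qed
  then show ?thesis using small const_regsD[OF r] by (simp add: rounds_prog_def)
qed

lemma wp_main:
  assumes r: "r 20 = nv" "r 2 = ne" "r 3 = k" "r 4 = 0" "r 0 = 0"
    and g: "loaded g" "\<forall>j<16. \<forall>x. g j x = 0"
  shows "wp main_prog (\<lambda>r g t. r 0 = mer_count k \<and> t \<le> 2000 * max 1 ((nv + ne) * k)) r g 0"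
    (is "wp _ ?Q _ _ _")
proof (cases "nv = 0")
  case True
  then have "mer_count k = 0" "r 20 = 0" using r by simp_all
  moreover have "1 < (2 :: nat) ^ w" using small by linarith
  ultimately show ?thesis using r(4,5) unfolding main_prog_def by (simp del: max_def)
next
  case False
  define n1 where "n1 = nv + ne + 1"
  let ?r = "r(5 := 1)"
  have regs: "const_regs k ?r" using r by (simp add: const_regs_def)
  have "wp identity_prog (wp (link_prog 17 0 1 2) (wp (gather_prog 1 2 3) (wp (link_prog 18 3 4 5)
      (wp (gather_prog 4 5 6) (wp init_prog (wp rounds_prog ?Q)))))) ?r g 2"
  proof (rule wp_identity[OF regs])
    fix r1 g1 t1
    assume 1: "const_regs k r1" "\<forall>j. j \<noteq> 0 \<longrightarrow> g1 j = g j" "\<forall>p<ne. g1 0 p = p + 1"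
      "t1 \<le> 2 + 20 * (nv + ne + 1)"
    have l1: "loaded g1" using g 1 by (simp add: loaded_def)
    show "wp (link_prog 17 0 1 2) (wp (gather_prog 1 2 3) (wp (link_prog 18 3 4 5)
      (wp (gather_prog 4 5 6) (wp init_prog (wp rounds_prog ?Q))))) r1 g1 t1"
    proof (rule wp_link[OF 1(1), where src = "[1..<ne + 1]"])
      show "set [1..<ne + 1] = {1..ne}"
        by (simp add: atLeastLessThanSuc_atLeastAtMost del: upt_Suc)
      show "\<forall>p<ne. g1 0 p = [1..<ne + 1] ! p" using 1(3) by (simp add: nth_upt del: upt_Suc)
      show "\<forall>x. g1 1 x = 0" using 1(2) g by simp
      show "\<forall>e\<in>{1..ne}. g1 17 e < nv" using l1 ends by (simp add: loaded_def)
    next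
      fix r2 g2 t2
      assume 2: "const_regs k r2" "\<forall>j. j \<noteq> 1 \<and> j \<noteq> 2 \<longrightarrow> g2 j = g1 j"
        "\<forall>x. chain (g2 2) (g2 1 x) (filter (\<lambda>e. g1 17 e = x) [1..<ne + 1])"
        "t2 \<le> t1 + 40 * (nv + ne + 1)"
      have l2: "loaded g2" using l1 2 by (simp add: loaded_def)
      show "wp (gather_prog 1 2 3) (wp (link_prog 18 3 4 5)
        (wp (gather_prog 4 5 6) (wp init_prog (wp rounds_prog ?Q)))) r2 g2 t2"
      proof (rule wp_gather[OF 2(1) _ _ _ _ _ ids(1) _ _ 2(3)])
        have out: "concat (map (\<lambda>x. filter (\<lambda>e. g1 17 e = x) [1..<ne + 1]) ids) = by_src"
          using l1 by (simp add: loaded_def by_src_def bucket_def)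
        then show "length (concat (map (\<lambda>x. filter (\<lambda>e. g1 17 e = x) [1..<ne + 1]) ids)) = ne"
          by (simp only: by_src)
        show "\<forall>i<nv. g2 16 i = ids ! i" using l2 by (simp add: loaded_def)
        show "set ids \<subseteq> {..<nv}" by (simp add: ids)
        show "\<forall>x. set (filter (\<lambda>e. g1 17 e = x) [1..<ne + 1]) \<subseteq> {1..ne}" by auto
        fix r3 g3 t3
        assume 3: "const_regs k r3" "\<forall>j. j \<noteq> 3 \<longrightarrow> g3 j = g2 j"
          "\<forall>p<ne. g3 3 p = concat (map (\<lambda>x. filter (\<lambda>e. g1 17 e = x) [1..<ne + 1]) ids) ! p"
          "t3 \<le> t2 + 40 * (nv + ne + 1)"
        have l3: "loaded g3" using l2 3 by (simp add: loaded_def)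
        show "wp (link_prog 18 3 4 5)
          (wp (gather_prog 4 5 6) (wp init_prog (wp rounds_prog ?Q))) r3 g3 t3"
        proof (rule wp_link[OF 3(1) _ _ _ _ _ _ _ by_src(3,2,1)])
          show "\<forall>p<ne. g3 3 p = by_src ! p" using 3(3) unfolding out .
          show "\<forall>x. g3 4 x = 0" using 1(2) 2(2) 3(2) g by simp
          show "\<forall>e\<in>{1..ne}. g3 18 e < nv" using l3 ends by (simp add: loaded_def)
        next
          fix r4 g4 t4
          assume 4: "const_regs k r4" "\<forall>j. j \<noteq> 4 \<and> j \<noteq> 5 \<longrightarrow> g4 j = g3 j"
            "\<forall>x. chain (g4 5) (g4 4 x) (filter (\<lambda>e. g3 18 e = x) by_src)"
            "t4 \<le> t3 + 40 * (nv + ne + 1)"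
          have l4: "loaded g4" using l3 4 by (simp add: loaded_def)
          show "wp (gather_prog 4 5 6) (wp init_prog (wp rounds_prog ?Q)) r4 g4 t4"
          proof (rule wp_gather[OF 4(1) _ _ _ _ _ ids(1) _ _ 4(3)])
            have out: "concat (map (\<lambda>x. filter (\<lambda>e. g3 18 e = x) by_src) ids) = by_tgt"
              using l3 by (simp add: loaded_def by_tgt_def bucket_def)
            then show "length (concat (map (\<lambda>x. filter (\<lambda>e. g3 18 e = x) by_src) ids)) = ne"
              by (simp only: by_tgt)
            show "\<forall>i<nv. g4 16 i = ids ! i" using l4 by (simp add: loaded_def)
            show "set ids \<subseteq> {..<nv}" by (simp add: ids)
            show "\<forall>x. set (filter (\<lambda>e. g3 18 e = x) by_src) \<subseteq> {1..ne}" by (auto simp: by_src)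
            fix r5 g5 t5
            assume 5: "const_regs k r5" "\<forall>j. j \<noteq> 6 \<longrightarrow> g5 j = g4 j"
              "\<forall>p<ne. g5 6 p = concat (map (\<lambda>x. filter (\<lambda>e. g3 18 e = x) by_src) ids) ! p"
              "t5 \<le> t4 + 40 * (nv + ne + 1)"
            show "wp init_prog (wp rounds_prog ?Q) r5 g5 t5"
            proof (rule wp_init[OF 5(1)])
              fix r6 g6 t6
              assume 6: "const_regs k r6" "\<forall>j. j \<noteq> 8 \<longrightarrow> g6 j = g5 j" "\<forall>x<nv. g6 8 x = 1"
                "t6 \<le> t5 + 20 * (nv + ne + 1)"
              show "wp rounds_prog ?Q r6 g6 t6"
              proof (rule wp_rounds[OF 6(1)])
                show "loaded g6" using l4 5 6 by (simp add: loaded_def)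
                show "\<forall>p<ne. g6 6 p = by_tgt ! p" using 5(3) 6(2) unfolding out by simp
                show "\<forall>x<nv. g6 7 x = 0" "\<forall>x<nv. g6 10 x = 0"
                  using 1(2) 2(2) 3(2) 4(2) 5(2) 6(2) g by simp_all
                show "\<forall>x<nv. g6 8 x = 1" by fact
                show "0 < nv" using False by simp
                fix r7 g7 t7
                assume 7: "r7 0 = mer_count k" "t7 \<le> t6 + 3 + k * (200 * (nv + ne + 1))"
                define X where "X = (nv + ne) * k"
                \<comment> \<open>A nonempty node set absorbs the summand 1 of \<open>n1\<close>
                  into the product with \<open>k\<close>, and \<open>k >= 1\<close> absorbs the cost
                  of sorting.\<close>
                have "k * 1 \<le> k * (nv + ne)" using False by (intro mult_le_mono2) simp
                then have "k * n1 \<le> 2 * X" by (simp add: n1_def X_def algebra_simps)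
                moreover have "n1 \<le> k * n1" using k by simp
                moreover have "t7 \<le> 5 + 200 * n1 + k * (200 * n1)"
                  using 1(4) 2(4) 3(4) 4(4) 5(4) 6(4) 7(2) unfolding n1_def[symmetric]
                  by linarith
                moreover have "k * (200 * n1) = 200 * (k * n1)" by simp
                moreover have "1 \<le> n1" by (simp add: n1_def)
                moreover have "X \<le> max 1 X" by simp
                ultimately have "t7 \<le> 2000 * max 1 X" by linarith
                with 7(1) show "r7 0 = mer_count k \<and> t7 \<le> 2000 * max 1 ((nv + ne) * k)"
                  by (simp only: X_def)
              qed
            qed
          qed simp_all
        qed simp_all
      qed simp_all
    qed simp_all
  qed
  moreover have "wp (c1 ;; c2) Q = wp c1 (wp c2 Q)" for c1 c2 Q
    by (simp add: fun_eq_iff)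
  ultimately show ?thesis using False r small by (simp add: main_prog_def numeral_2_eq_2)
qed

end

section \<open>The machine program and its encoded input\<close>

definition prologue :: "instr list" where
  "prologue =
     [Const 51 0, Load 20 51, Const 51 1, Load 2 51, Const 51 2, Load 3 51, Op Add 53 20 54,
      Const 51 3, Op Mul 52 2 51, Op Add 50 20 51, Op Add 50 50 52]"

definition kmer_program :: "instr list" where
  "kmer_program = prologue @ compile main_prog (length prologue)"

lemma regs_bounded_main: "regs_bounded main_prog"
  by (simp add: main_prog_def identity_prog_def link_prog_def gather_prog_def init_prog_def
      rounds_prog_def pass_prog_def process_prog_def copy_prog_def)

lemma concat_triples_nth:
  assumes "i < length es" "c < 3"
  shows "concat (map (\<lambda>(u, v, a). [f u, g v, h a]) es) ! (3 * i + c) =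
    (case es ! i of (u, v, a) \<Rightarrow> [f u, g v, h a] ! c)"
  using assms
proof (induction es arbitrary: i)
  case (Cons e es)
  obtain u v a where "e = (u, v, a)" by (cases e)
  moreover have "c = 0 \<or> c = 1 \<or> c = 2" using \<open>c < 3\<close> by auto
  ultimately show ?case using Cons by (cases i) (auto simp: nth_append)
qed simp

lemma length_concat_triples:
  "length (concat (map (\<lambda>(u, v, a). [f u, g v, h a]) es)) = 3 * length es"
  by (induction es) auto

text \<open>The prologue consists of bare machine instructions because compiled memory accesses
  already rely on the base addresses in registers 50 and 53, which it sets up; register 54 keeps its
  initial 0.\<close>

lemma (in layout) simulates_prologue:
  assumes xs: "xs = [nv, ne, k] @ ids @ concat (map (\<lambda>(u, v, a). [u, v, a]) es)"
    and len: "length ids = nv" "length es = ne" and small: "\<forall>x\<in>set xs. x < 2 ^ w"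
    and g: "\<forall>j<16. \<forall>x. g j x = 0" "\<forall>i<nv. g 16 i = ids ! i"
      "\<forall>e\<in>{1..ne}. (g 17 e, g 18 e, g 19 e) = es ! (e - 1)"
  shows "simulates ((\<lambda>_. 0)(20 := nv, 2 := ne, 3 := k)) g
    (fold (exec w) prologue (ram_init xs))"
proof -
  have word: "3 < (2 :: nat) ^ w" "nv < 2 ^ w" "ne < 2 ^ w" "nv + 3 + ne * 3 < 2 ^ w"
  proof -
    define W where "W = (2 :: nat) ^ w"
    have "20 * (nv + ne) + 20 \<le> W" using word_size by (simp add: W_def)
    then have "3 < W \<and> nv < W \<and> ne < W \<and> nv + 3 + ne * 3 < W" by auto
    then show "3 < (2 :: nat) ^ w" "nv < 2 ^ w" "ne < 2 ^ w" "nv + 3 + ne * 3 < 2 ^ w"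
      by (simp_all add: W_def)
  qed
  have "k < 2 ^ w" using small xs by simp
  have len_xs: "length xs = 3 + nv + 3 * ne"
    using length_concat_triples[of "\<lambda>x. x" "\<lambda>x. x" "\<lambda>x. x" es] len by (simp add: xs)
  define s where "s = fold (exec w) prologue (ram_init xs)"
  have mem: "mem s = (\<lambda>i. if i < length xs then xs ! i else 0)"
    by (simp add: s_def prologue_def ram_init_def)
  have reg: "reg s = (\<lambda>_. 0)(51 := 3, 20 := nv, 2 := ne, 3 := k, 53 := nv, 52 := 3 * ne,
      50 := 3 + nv + 3 * ne)"
    using word \<open>k < 2 ^ w\<close>
    by (auto simp: s_def prologue_def ram_init_def xs fun_eq_iff)
  have "mem s (addr j i) = g j i" if v: "valid j i" for j i
  proof -
    consider "j < 16" | "j = 16" "i < nv" | "17 \<le> j" "j < 20" "1 \<le> i" "i \<le> ne"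
      using v by (auto simp: valid_def)
    then show ?thesis
    proof cases
      case 1
      then show ?thesis using g by (simp add: mem len_xs addr_def base_def)
    next
      case 2
      then show ?thesis using g len len_xs
        by (simp add: mem addr_def base_def stride_def offset_def xs nth_append)
    next
      case 3
      define e c where "e = i - 1" and "c = j - 17"
      have i: "i = Suc e" "e < length es" and j: "j = 17 + c" "c < 3"
        using 3 len by (auto simp: e_def c_def)
      have "addr j i = 3 + (nv + (3 * e + c))"
        using i j by (simp add: addr_def base_def stride_def offset_def)
      moreover have "3 + (nv + (3 * e + c)) < length xs"
        using i j len len_xs by simp
      moreover have "xs ! (3 + (nv + (3 * e + c))) =
          concat (map (\<lambda>(u, v, a). [u, v, a]) es) ! (3 * e + c)"
        using len by (simp add: xs nth_append)
      moreover have "\<dots> = (case es ! e of (u, v, a) \<Rightarrow> [u, v, a] ! c)"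
        using concat_triples_nth[of e es c "\<lambda>x. x" "\<lambda>x. x" "\<lambda>x. x"] i j by simp
      moreover have "es ! e = (g 17 i, g 18 i, g 19 i)" using g(3) 3 by (simp add: e_def)
      moreover have "c = 0 \<or> c = 1 \<or> c = 2" using j by auto
      ultimately show ?thesis using j by (auto simp: mem)
    qed
  qed
  moreover have "mem s a < 2 ^ w" for a using small by (auto simp: mem)
  moreover have "reg s x < 2 ^ w" for x using word \<open>k < 2 ^ w\<close> by (auto simp: reg)
  ultimately show ?thesis
    unfolding s_def[symmetric] simulates_def by (auto simp: reg)
qed

lemma (in wheeler_input) ram_computes:
  assumes xs: "xs = [nv, ne, k] @ ids @ concat (map (\<lambda>(u, v, a). [u, v, a]) es)"
    and es: "length es = ne" "\<forall>e\<in>{1..ne}. edge e = es ! (e - 1)"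
    and small: "\<forall>x\<in>set xs. x < 2 ^ w"
  shows "ram_computes_within w kmer_program xs (mer_count k) (3000 * max 1 ((nv + ne) * k))"
proof -
  define g where "g j = (if j < 16 then (\<lambda>_. 0) else if j = 16 then (!) ids
      else if j = 17 then src else if j = 18 then tgt else lab)" for j :: nat
  define s where "s = fold (exec w) prologue (ram_init xs)"
  let ?r = "(\<lambda>_. 0 :: nat)(20 := nv, 2 := ne, 3 := k)"
  have sim: "simulates ?r g s" unfolding s_def
    by (rule simulates_prologue[OF xs ids(1) es(1) small])
      (use es(2) in \<open>auto simp: g_def\<close>)
  have "segment_at kmer_program (pc (ram_init xs)) prologue"
    unfolding kmer_program_def segment_at_def
    by (rule exI[of _ "[]"]) (simp add: ram_init_def)
  from ram_step_straight[OF this]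
  have start: "(ram_step w kmer_program ^^ length prologue) (ram_init xs) = s"
    and pc: "pc s = length prologue"
    by (simp_all add: s_def prologue_def ram_init_def)
  have "wp main_prog (\<lambda>r g t. r 0 = mer_count k \<and> t \<le> 2000 * max 1 ((nv + ne) * k)) ?r g 0"
    by (rule wp_main) (auto simp: loaded_def g_def)
  then obtain r' g' t' where fin: "big main_prog ?r g 0 r' g' t'" "r' 0 = mer_count k"
      "t' \<le> 2000 * max 1 ((nv + ne) * k)"
    unfolding wp_def by blast
  have "segment_at kmer_program (pc s) (compile main_prog (pc s))"
    unfolding pc kmer_program_def segment_at_def
    by (rule exI[of _ prologue], rule exI[of _ "[]"]) simp
  from simulates_compile[OF fin(1) regs_bounded_main this sim] obtain s' where
    s': "(ram_step w kmer_program ^^ t') s = s'" "pc s' = pc s + code_size main_prog"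
      "simulates r' g' s'"
    by auto
  have run: "(ram_step w kmer_program ^^ (t' + length prologue)) (ram_init xs) = s'"
    unfolding funpow_add comp_apply start s'(1) ..
  \<comment> \<open>The 11 steps of the prologue and the factor 2000 of the main program fit into
    3000.\<close>
  have "length prologue \<le> 11 * max 1 ((nv + ne) * k)"
    by (simp add: prologue_def)
  then have "t' + length prologue \<le> 3000 * max 1 ((nv + ne) * k)"
    using fin(3) by linarith
  moreover have "halted kmer_program s'"
    using s'(2) pc by (simp add: halted_def kmer_program_def)
  moreover have "reg s' 0 = mer_count k" using s'(3) fin(2) by (simp add: simulates_def)
  ultimately show ?thesis
    unfolding ram_computes_within_def using run by blast
qed

lemma kmer_program_correct:
  fixes A :: "'a::linorder set" and V :: "'v set"
  assumes G: "labeled_graph A V E" and det: "deterministic E" and wh: "wheeler_order V E r"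
    and k: "1 \<le> k" and ws: "word_size_sufficient 20 w A V E k"
    and enc: "encodes_input w A V E r k xs"
  shows "ram_computes_within w kmer_program xs (card (kmers A V E k))
    (3000 * max 1 ((card V + card E) * k))"
proof -
  have E: "E \<subseteq> V \<times> V \<times> A" using G by (simp add: labeled_graph_def)
  from enc obtain node_id code vs es where
    id: "bij_betw node_id V {..<card V}" and code: "strict_mono_on A code" "code ` A \<subseteq> {..<2 ^ w}"
    and vs: "distinct vs" "set vs = V" "sorted_wrt (\<lambda>u v. (u, v) \<in> r) vs"
    and es: "distinct es" "set es = E"
    and xs: "xs = [card V, card E, k] @ map node_id vs @
             concat (map (\<lambda>(u, v, a). [node_id u, node_id v, code a]) es)"
    unfolding encodes_input_def by blast
  define nv ne where "nv = card V" and "ne = card E"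
  have len: "length vs = nv" "length es = ne"
    using distinct_card[OF vs(1)] distinct_card[OF es(1)] vs es by (simp_all add: nv_def ne_def)
  define W where "W = (2 :: nat) ^ w"
  have "20 * (max_mers A V E k + nv + ne + k) < W"
    using ws by (simp add: word_size_sufficient_def nv_def ne_def W_def)
  \<comment> \<open>The summand \<open>k >= 1\<close> of the word size assumption supplies the
    additive constant 20.\<close>
  then have "20 * (nv + ne) + 20 \<le> W \<and> max_mers A V E k < W \<and> nv < W \<and> ne < W \<and> k < W"
    using k by auto
  then have size: "20 * (nv + ne) + 20 \<le> 2 ^ w" "max_mers A V E k < 2 ^ w"
      "nv < 2 ^ w" "ne < 2 ^ w" "k < 2 ^ w"
    by (simp_all only: W_def)
  have inj_id: "inj_on node_id V" and id_V: "node_id ` V = {..<nv}"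
    using id by (auto simp: bij_betw_def nv_def)
  have inj_code: "inj_on code A" using code(1) by (rule strict_mono_on_imp_inj_on)
  define ids where "ids = map node_id vs"
  have ids: "length ids = nv" "distinct ids" "set ids = {..<nv}"
    using len vs inj_id id_V by (simp_all add: ids_def distinct_map)
  \<comment> \<open>The rank is the position in the given list of nodes, which turns the relation
    \<open>r\<close> into a comparison of numbers.\<close>
  define rk where "rk x = (THE i. i < nv \<and> ids ! i = x)" for x
  have rk_nth: "rk (ids ! i) = i" if "i < nv" for i
    unfolding rk_def using that ids(1,2) by (intro the_equality) (auto simp: nth_eq_iff_index_eq)
  have sorted: "sorted_wrt (\<lambda>x y. rk x < rk y) ids"
    unfolding sorted_wrt_iff_nth_less using rk_nth ids(1) by auto
  have inj_rk: "inj_on rk {..<nv}"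
    unfolding ids(3)[symmetric] by (auto simp: inj_on_def in_set_conv_nth ids(1) rk_nth)
  have order: "irrefl r" "trans r" using wh
    by (auto simp: wheeler_order_def strict_linear_order_on_def)
  have rk_r: "rk (node_id u) < rk (node_id v) \<longleftrightarrow> (u, v) \<in> r" if uv: "u \<in> V" "v \<in> V" for u v
  proof -
    from uv vs(2) len obtain i j where ij: "i < nv" "j < nv" "u = vs ! i" "v = vs ! j"
      by (metis in_set_conv_nth)
    then have rk: "rk (node_id u) = i" "rk (node_id v) = j"
      using rk_nth[of i] rk_nth[of j] len by (simp_all add: ids_def)
    have lt: "(vs ! i, vs ! j) \<in> r" if "i < j" "j < nv" for i j
      using sorted_wrt_nth_less[OF vs(3), of i j] that len by simp
    have "(u, v) \<notin> r" if "\<not> i < j"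
      using that lt[of j i] ij order by (cases "i = j") (auto simp: irrefl_def dest: transD)
    then show ?thesis using lt[of i j] ij rk by auto
  qed
  define enc where "enc = (\<lambda>(u, v, a). (node_id u, node_id v, code a))"
  define es' where "es' = map enc es"
  define src tgt lab where "src e = fst (es' ! (e - 1))" and "tgt e = fst (snd (es' ! (e - 1)))"
    and "lab e = snd (snd (es' ! (e - 1)))" for e
  have edge: "(src e, tgt e, lab e) = es' ! (e - 1)" for e
    by (simp add: src_def tgt_def lab_def)
  have edge_E: "\<exists>u v a. es ! (e - 1) = (u, v, a) \<and> (u, v, a) \<in> E \<and> u \<in> V \<and> v \<in> V \<and> a \<in> A \<and>
      src e = node_id u \<and> tgt e = node_id v \<and> lab e = code a" if "e \<in> {1..ne}" for e
  proof -
    have *: "e - 1 < length es" using that len by auto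
    obtain u v a where uva: "es ! (e - 1) = (u, v, a)" by (cases "es ! (e - 1)")
    with nth_mem[OF *] es(2) have "(u, v, a) \<in> E" by simp
    with E uva * show ?thesis by (auto simp: src_def tgt_def lab_def es'_def enc_def)
  qed
  have edges: "(\<lambda>e. (src e, tgt e, lab e)) ` {1..ne} = enc ` E"
  proof -
    have "(\<lambda>e. e - 1) ` {1..ne} = {..<ne}"
      by (force simp: image_iff)
    then have "(\<lambda>e. es' ! (e - 1)) ` {1..ne} = (!) es' ` {..<ne}"
      by (metis (no_types, lifting) image_cong image_image)
    also have "\<dots> = set es'"
    proof -
      have "length es' = ne" using len by (simp add: es'_def)
      then show ?thesis by (auto simp: set_conv_nth)
    qed
    finally show ?thesis unfolding edge by (simp add: es'_def es(2))
  qed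
  have card_mers: "card (\<Union>x<nv. mers ((\<lambda>e. (src e, tgt e, lab e)) ` {1..ne}) l x) =
      card (kmers A V E l)" for l
    unfolding edges enc_def id_V[symmetric] by (rule card_mers_encode[OF E inj_id inj_code])
  have max: "card (kmers A V E l) \<le> max_mers A V E k" if "1 \<le> l" "l \<le> k" for l
    unfolding max_mers_def using that by (intro Max_ge) auto
  interpret ranked_nodes "{..<nv}" rk by unfold_locales (rule inj_rk)
  interpret wheeler_input w nv ne rk ids src tgt lab k
  proof unfold_locales
    show "20 * (nv + ne) + 20 \<le> 2 ^ w" by (rule size)
    show "length ids = nv" "distinct ids" "set ids = {..<nv}"
      "sorted_wrt (\<lambda>x y. rk x < rk y) ids" by fact+
    show "src e < nv \<and> tgt e < nv" if "e \<in> {1..ne}" for e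
      using edge_E[OF that] id_V by auto
    show "lab e < 2 ^ w" if "e \<in> {1..ne}" for e using edge_E[OF that] code(2) by auto
    show "edge_less (src d, tgt d, lab d) (src e, tgt e, lab e)"
      if de: "d \<in> {1..ne}" "e \<in> {1..ne}" "d \<noteq> e" and
        less: "rk (tgt d) < rk (tgt e) \<or> tgt d = tgt e \<and> (rk (src d) < rk (src e) \<or> src d = src e)"
      for d e
    proof -
      obtain u v a where d: "es ! (d - 1) = (u, v, a)" "(u, v, a) \<in> E" "u \<in> V" "v \<in> V" "a \<in> A"
        "src d = node_id u" "tgt d = node_id v" "lab d = code a"
        using edge_E[OF de(1)] by blast
      obtain u' v' a' where e: "es ! (e - 1) = (u', v', a')" "(u', v', a') \<in> E" "u' \<in> V" "v' \<in> V"
        "a' \<in> A" "src e = node_id u'" "tgt e = node_id v'" "lab e = code a'"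
        using edge_E[OF de(2)] by blast
      have "d - 1 < length es" "e - 1 < length es" "d - 1 \<noteq> e - 1" using de len by auto
      then have neq: "(u, v, a) \<noteq> (u', v', a')"
        using nth_eq_iff_index_eq[OF es(1)] d(1) e(1) by metis
      have ord: "rk (node_id v) < rk (node_id v') \<or>
          v = v' \<and> (rk (node_id u) < rk (node_id u') \<or> u = u')"
        using less d e inj_id by (auto simp: inj_on_eq_iff)
      have "a \<le> a' \<and> rk (node_id v) \<le> rk (node_id v') \<and>
          (a = a' \<longrightarrow> rk (node_id u) < rk (node_id u'))"
        using rk_r by (rule wheeler_sorted_edges[OF E det wh _ d(2) e(2) neq ord])
      then show ?thesis
        using d e code(1) inj_code
        by (auto simp: edge_less_def inj_on_eq_iff strict_mono_on_leD)
    qed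
    show "1 \<le> k" by fact
    show "k < 2 ^ w" by (rule size)
    show "card (\<Union>x<nv. mers ((\<lambda>e. (src e, tgt e, lab e)) ` {1..ne}) l x) < 2 ^ w"
      if "1 \<le> l" "l \<le> k" for l
      unfolding card_mers using max[OF that] size(2) by (rule le_less_trans)
  qed
  have xs': "xs = [nv, ne, k] @ ids @ concat (map (\<lambda>(u, v, a). [u, v, a]) es')"
    unfolding xs nv_def ne_def ids_def es'_def enc_def
    by (simp add: comp_def case_prod_unfold)
  have "\<forall>x\<in>set xs. x < 2 ^ w"
  proof
    fix x assume "x \<in> set xs"
    then consider "x = nv" | "x = ne" | "x = k" | "x \<in> {..<nv}" | "x \<in> code ` A"
      unfolding xs using E id_V vs(2) es(2) by (fastforce simp: nv_def ne_def)
    then show "x < 2 ^ w"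
    proof cases
      case 5
      then show ?thesis using code(2) by auto
    next
      case 4
      then show ?thesis using size(3) by simp
    qed (simp_all add: size)
  qed
  then have "ram_computes_within w kmer_program xs (mer_count k) (3000 * max 1 ((nv + ne) * k))"
    using len edge by (intro ram_computes[OF xs']) (simp_all add: es'_def)
  then show ?thesis unfolding card_mers by (simp only: nv_def ne_def)
qed

theorem theorem9:
  shows "\<exists>P C D. \<forall>(A :: nat set) (V :: nat set) E r k w xs.
    labeled_graph A V E \<longrightarrow> deterministic E \<longrightarrow> wheeler_order V E r \<longrightarrow> 1 \<le> k \<longrightarrow>
    word_size_sufficient D w A V E k \<longrightarrow> encodes_input w A V E r k xs \<longrightarrow>
    ram_computes_within w P xs (card (kmers A V E k)) (C * max 1 ((card V + card E) * k))"
  using kmer_program_correct by blast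

end
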